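(* Let $N=n_1\cdots n_d$ with $n_1,\dots,n_d$ positive integers. Then the following statements hold. (a) The linear subspace $\mathcal{L}(\mathbb{R}^{N\times N})$ of Laplacian-like matrices is a Lie subalgebra of the matrix Lie algebra $\mathbb{R}^{N\times N}$. (b) The matrix group $$\mathfrak{L}(\mathbb{R}^{N\times N})=\left\{\bigotimes_{i=1}^d A_i : A_i\in GL(\mathbb{R}^{n_i})\text{ for }1\le i\le d\right\}$$ is a Lie subgroup of $GL(\mathbb{R}^N)$. (c) The exponential map $$\exp:\mathcal{L}(\mathbb{R}^{N\times N})\longrightarrow\mathfrak{L}(\mathbb{R}^{N\times N}),\qquad \sum_{i=1}^d \mathrm{id}_{n_1}\otimes\cdots\otimes\mathrm{id}_{n_{i-1}}\otimes A_i\otimes\mathrm{id}_{n_{i+1}}\otimes\cdots\otimes\mathrm{id}_{n_d}\ \mapsto\ \bigotimes_{i=1}^d\exp(A_i),$$ is well defined; that is, the matrix exponential maps $\mathcal{L}(\mathbb{R}^{N\times N})$ into $\mathfrak{L}(\mathbb{R}^{N\times N})$ and is given there by this formula.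
   Context: Fix a factorization $N=n_1\cdots n_d$; $\otimes$ denotes the Kronecker product of matrices and $\mathrm{id}_n$ the $n\times n$ identity matrix. A matrix $A\in\mathbb{R}^{N\times N}$ is Laplacian-like if there exist $A_i\in\mathbb{R}^{n_i\times n_i}$, $1\le i\le d$, such that $A=\sum_{i=1}^d \mathrm{id}_{n_1}\otimes\cdots\otimes\mathrm{id}_{n_{i-1}}\otimes A_i\otimes\mathrm{id}_{n_{i+1}}\otimes\cdots\otimes\mathrm{id}_{n_d}$. The set of Laplacian-like matrices (for the fixed factorization) is a linear subspace denoted $\mathcal{L}(\mathbb{R}^{N\times N})$. $GL(\mathbb{R}^n)$ is the group of non-singular matrices in $\mathbb{R}^{n\times n}$. The Lie bracket on $\mathbb{R}^{N\times N}$ is $[A,B]=AB-BA$; a linear subspace $\mathfrak{h}\subset\mathbb{R}^{N\times N}$ is a Lie subalgebra if $[A,B]\in\mathfrak{h}$ for all $A,B\in\mathfrak{h}$. The matrix exponential is $\exp(A)=\sum_{n=0}^\infty A^n/n!$. *)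

theory Defs
  imports
    "HOL-Analysis.Abstract_Euclidean_Space"
    "HOL-Analysis.Derivative"
    "Jordan_Normal_Form.VS_Connect"
begin

definition kron :: "real mat \<Rightarrow> real mat \<Rightarrow> real mat" where
  "kron A B = mat (dim_row A * dim_row B) (dim_col A * dim_col B)
     (\<lambda>(i, j). A $$ (i div dim_row B, j div dim_col B) * B $$ (i mod dim_row B, j mod dim_col B))"

text \<open>The \<open>1 \<times> 1\<close> identity closing the fold is neutral for the Kronecker product.\<close>

definition kron_list :: "real mat list \<Rightarrow> real mat" where
  "kron_list As = foldr kron As (1\<^sub>m 1)"

text \<open>The list \<open>(map 1\<^sub>m ns)[i := A i]\<close> consists of identity matrices, except for
  \<open>A i\<close> in position \<open>i\<close>.\<close>

definition laplacian_sum :: "nat list \<Rightarrow> real mat list \<Rightarrow> real mat" where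
  "laplacian_sum ns As =
     finsum (module_mat TYPE(real) (prod_list ns) (prod_list ns))
       (\<lambda>i. kron_list ((map 1\<^sub>m ns)[i := As ! i])) {..<length ns}"

definition laplacian_like :: "nat list \<Rightarrow> real mat set" where
  "laplacian_like ns =
     {laplacian_sum ns As | As. list_all2 (\<lambda>n A. A \<in> carrier_mat n n) ns As}"

definition GL :: "nat \<Rightarrow> real mat monoid" where
  "GL n = units_of (ring_mat TYPE(real) n ())"

definition kron_group :: "nat list \<Rightarrow> real mat set" where
  "kron_group ns = {kron_list As | As. list_all2 (\<lambda>n A. A \<in> carrier (GL n)) ns As}"

definition lie_subalgebra :: "nat \<Rightarrow> real mat set \<Rightarrow> bool" where
  "lie_subalgebra n h \<longleftrightarrow>
     VectorSpace.subspace class_ring h (module_mat TYPE(real) n n) \<and>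
     (\<forall>A\<in>h. \<forall>B\<in>h. A * B - B * A \<in> h)"

definition mat_exp :: "real mat \<Rightarrow> real mat" where
  "mat_exp A = mat (dim_row A) (dim_row A) (\<lambda>(i, j). \<Sum>k. (A ^\<^sub>m k) $$ (i, j) / fact k)"

text \<open>The entrywise series defining \<open>mat_exp\<close> converges for every square matrix, so
  \<open>suminf\<close> is never applied to a divergent series there.\<close>

lemma summable_mat_exp_entry:
  fixes A :: "real mat"
  assumes A: "A \<in> carrier_mat n n" and ij: "i < n" "j < n"
  shows "summable (\<lambda>k. (A ^\<^sub>m k) $$ (i, j) / fact k)"
proof -
  define c where "c = (\<Sum>p\<in>{..<n} \<times> {..<n}. \<bar>A $$ p\<bar>)"
  have c: "\<bar>A $$ (l, m)\<bar> \<le> c" if "l < n" "m < n" for l m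
    unfolding c_def by (rule member_le_sum[of "(l, m)"]) (use that in auto)
  have c0: "0 \<le> c" unfolding c_def by (rule sum_nonneg) auto
  have bound: "\<bar>(A ^\<^sub>m k) $$ (i, m)\<bar> \<le> (real n * c) ^ k" if "m < n" for k m
    using that
  proof (induction k arbitrary: m)
    case 0
    then show ?case using A ij by auto
  next
    case (Suc k)
    have Ak: "A ^\<^sub>m k \<in> carrier_mat n n" using A by simp
    have "(A ^\<^sub>m Suc k) $$ (i, m) = (\<Sum>l<n. (A ^\<^sub>m k) $$ (i, l) * A $$ (l, m))"
      using A Ak ij Suc.prems by (simp add: scalar_prod_def lessThan_atLeast0)
    also have "\<bar>\<dots>\<bar> \<le> (\<Sum>l<n. (real n * c) ^ k * c)"
      by (rule order_trans[OF sum_abs], rule sum_mono)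
         (auto simp: abs_mult c0 intro!: mult_mono Suc.IH c Suc.prems)
    finally show ?case by (simp add: mult_ac)
  qed
  have "summable (\<lambda>k. (real n * c) ^ k / fact k)"
    using summable_exp[of "real n * c"] by (simp add: field_simps)
  then show ?thesis
    by (rule summable_comparison_test'[where N = 0])
       (auto simp: bound ij divide_right_mono)
qed

text \<open>Differential calculus on \<open>Euclidean_space n\<close>, whose points are the sequences
  vanishing from index \<open>n\<close> on.\<close>

definition partial_deriv :: "nat \<Rightarrow> ((nat \<Rightarrow> real) \<Rightarrow> real) \<Rightarrow> (nat \<Rightarrow> real) \<Rightarrow> real" where
  "partial_deriv i f x = deriv (\<lambda>t. f (x(i := t))) (x i)"

text \<open>\<open>C_diff k n U f\<close>: \<open>f\<close> is of class \<open>C\<^sup>k\<close> on the open set \<open>U\<close> of \<open>Euclidean_space n\<close>.\<close>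

primrec C_diff :: "nat \<Rightarrow> nat \<Rightarrow> (nat \<Rightarrow> real) set \<Rightarrow> ((nat \<Rightarrow> real) \<Rightarrow> real) \<Rightarrow> bool" where
  "C_diff 0 n U f \<longleftrightarrow> continuous_map (subtopology (Euclidean_space n) U) euclideanreal f"
| "C_diff (Suc k) n U f \<longleftrightarrow>
     continuous_map (subtopology (Euclidean_space n) U) euclideanreal f \<and>
     (\<forall>i<n. (\<forall>x\<in>U. (\<lambda>t. f (x(i := t))) field_differentiable at (x i)) \<and>
            C_diff k n U (partial_deriv i f))"

text \<open>A map on an arbitrary subset \<open>X\<close> of Euclidean space is smooth if near each point of
  \<open>X\<close> it is the restriction of a \<open>C\<^sup>\<infinity>\<close> map defined on an open set. For open \<open>X\<close> this is
  ordinary smoothness; for an embedded submanifold \<open>X\<close> it is smoothness with respect to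
  the manifold structure of \<open>X\<close>.\<close>

definition smooth_on ::
  "nat \<Rightarrow> nat \<Rightarrow> (nat \<Rightarrow> real) set \<Rightarrow> ((nat \<Rightarrow> real) \<Rightarrow> (nat \<Rightarrow> real)) \<Rightarrow> bool" where
  "smooth_on n m X f \<longleftrightarrow>
     X \<subseteq> topspace (Euclidean_space n) \<and>
     f ` X \<subseteq> topspace (Euclidean_space m) \<and>
     (\<forall>x\<in>X. \<exists>U g. openin (Euclidean_space n) U \<and> x \<in> U \<and>
        (\<forall>j<m. \<forall>k. C_diff k n U (\<lambda>y. g y j)) \<and>
        (\<forall>y\<in>X \<inter> U. \<forall>j<m. g y j = f y j))"

definition diffeo_on ::
  "nat \<Rightarrow> (nat \<Rightarrow> real) set \<Rightarrow> (nat \<Rightarrow> real) set \<Rightarrow> ((nat \<Rightarrow> real) \<Rightarrow> (nat \<Rightarrow> real)) \<Rightarrow> bool" where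
  "diffeo_on n U V \<phi> \<longleftrightarrow>
     bij_betw \<phi> U V \<and> smooth_on n n U \<phi> \<and> smooth_on n n V (inv_into U \<phi>)"

text \<open>\<open>k\<close>-dimensional embedded submanifolds of \<open>Euclidean_space n\<close>, by slice charts.\<close>

definition embedded_submanifold :: "nat \<Rightarrow> nat \<Rightarrow> (nat \<Rightarrow> real) set \<Rightarrow> bool" where
  "embedded_submanifold n k M \<longleftrightarrow>
     k \<le> n \<and> M \<subseteq> topspace (Euclidean_space n) \<and>
     (\<forall>p\<in>M. \<exists>U V \<phi>. p \<in> U \<and>
        openin (Euclidean_space n) U \<and> openin (Euclidean_space n) V \<and>
        diffeo_on n U V \<phi> \<and>
        \<phi> ` (M \<inter> U) = V \<inter> topspace (Euclidean_space k))"

text \<open>The row-major identification of \<open>n \<times> n\<close> matrices with \<open>Euclidean_space (n * n)\<close>.\<close>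

definition mat_coords :: "nat \<Rightarrow> real mat \<Rightarrow> nat \<Rightarrow> real" where
  "mat_coords n A = (\<lambda>k. if k < n * n then A $$ (k div n, k mod n) else 0)"

definition mat_of_coords :: "nat \<Rightarrow> (nat \<Rightarrow> real) \<Rightarrow> real mat" where
  "mat_of_coords n x = mat n n (\<lambda>(i, j). x (i * n + j))"

text \<open>A Lie subgroup of \<open>GL n\<close> is a subgroup that is an embedded submanifold and whose
  multiplication and inversion are smooth. As \<open>GL n\<close> is open in the space of all \<open>n \<times> n\<close>
  matrices, embedded submanifolds of \<open>GL n\<close> are the embedded submanifolds of that space
  contained in \<open>GL n\<close>. For the multiplication, a pair of matrices is given by its
  \<open>n * n + n * n\<close> coordinates.\<close>

definition lie_subgroup_GL :: "nat \<Rightarrow> real mat set \<Rightarrow> bool" where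
  "lie_subgroup_GL n H \<longleftrightarrow>
     subgroup H (GL n) \<and>
     (\<exists>k. embedded_submanifold (n * n) k (mat_coords n ` H)) \<and>
     smooth_on (n * n + n * n) (n * n)
       {z \<in> topspace (Euclidean_space (n * n + n * n)).
          mat_of_coords n z \<in> H \<and> mat_of_coords n (\<lambda>k. z (n * n + k)) \<in> H}
       (\<lambda>z. mat_coords n (mat_of_coords n z * mat_of_coords n (\<lambda>k. z (n * n + k)))) \<and>
     smooth_on (n * n) (n * n) (mat_coords n ` H)
       (\<lambda>x. mat_coords n (inv\<^bsub>GL n\<^esub> (mat_of_coords n x)))"

end

theory Submission
  imports Defs
begin

text \<open>The mixed-product rule makes the bracket of Laplacian-like matrices act factorwise, and it
  makes \<open>A \<otimes> 1\<close> and \<open>1 \<otimes> B\<close> commute, so that entrywise the exponential series of their sum is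
  the Cauchy product of the series of \<open>A\<close> and \<open>B\<close>.

  For the manifold structure, let \<open>p\<close> be the position of a nonzero entry of \<open>A\<^sub>1 \<otimes> \<dots> \<otimes> A\<^sub>d\<close>. The entry at
  a position \<open>q\<close> is \<open>x\<^sub>p\<close> times the product over \<open>t\<close> of the ratios \<open>x\<^sub>r / x\<^sub>p\<close>, where \<open>r\<close> arises from \<open>p\<close> by
  replacing its \<open>t\<close>-th component by that of \<open>q\<close>. Hence near this point the group is
  the graph of a rational function of the entries at positions that differ from \<open>p\<close> in at most
  one component, and rational functions are smooth because they are closed under
  partial derivatives. Inversion is smooth by Cramer's rule.\<close>

section \<open>Rational functions and graphs\<close>

text \<open>A slice chart needs a smooth inverse. A graph supplies one without an inverse function
  theorem: subtracting a function of some coordinates from the others is undone by adding it back.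
  The pivot varies from point to point, but the dimension may not; it is 1 plus the sum of the n_t^2
  - 1 for every pivot, because d - 1 of the parameters of the factors are scalars that can be moved
  from one factor to another.

  Points of the graph must also come from invertible factors. Up to scalars, the factors can be read
  off from the coordinates at positions that differ from p in one component, so nonvanishing of
  their determinants is an open condition on the very coordinates that the graph function uses, and
  it can be built into the chart domain.

  Exponentials are treated entry by entry as real series, and the Cauchy product requires absolute
  convergence of these.\<close>

inductive rational_on :: "(nat \<Rightarrow> real) set \<Rightarrow> ((nat \<Rightarrow> real) \<Rightarrow> real) \<Rightarrow> bool"
  for U where
  const: "rational_on U (\<lambda>x. c)"
| coord: "rational_on U (\<lambda>x. x j)"
| add: "rational_on U f \<Longrightarrow> rational_on U g \<Longrightarrow> rational_on U (\<lambda>x. f x + g x)"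
| mult: "rational_on U f \<Longrightarrow> rational_on U g \<Longrightarrow> rational_on U (\<lambda>x. f x * g x)"
| inverse: "rational_on U f \<Longrightarrow> (\<And>x. x \<in> U \<Longrightarrow> f x \<noteq> 0) \<Longrightarrow> rational_on U (\<lambda>x. inverse (f x))"

lemma rational_on_uminus: "rational_on U f \<Longrightarrow> rational_on U (\<lambda>x. - f x)"
  using rational_on.mult[OF rational_on.const[of U "-1"], of f] by simp

lemma rational_on_diff:
  "rational_on U f \<Longrightarrow> rational_on U g \<Longrightarrow> rational_on U (\<lambda>x. f x - g x)"
  using rational_on.add[OF _ rational_on_uminus[of U g], of f] by simp

lemma rational_on_sum:
  "(\<And>a. a \<in> A \<Longrightarrow> rational_on U (f a)) \<Longrightarrow> rational_on U (\<lambda>x. \<Sum>a\<in>A. f a x)"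
  by (induction A rule: infinite_finite_induct) (auto intro: rational_on.intros)

lemma rational_on_prod:
  "(\<And>a. a \<in> A \<Longrightarrow> rational_on U (f a)) \<Longrightarrow> rational_on U (\<lambda>x. \<Prod>a\<in>A. f a x)"
  by (induction A rule: infinite_finite_induct) (auto intro: rational_on.intros)

text \<open>Needed for the inverse of a chart, where the graph function is evaluated after permuting
  coordinates. Denominators stay nonzero because the reindexed point lies in
  \<open>U\<close>.\<close>

lemma rational_on_subst:
  assumes "rational_on U f" and "\<And>y. y \<in> V \<Longrightarrow> (\<lambda>j. y (\<tau> j)) \<in> U"
  shows "rational_on V (\<lambda>y. f (\<lambda>j. y (\<tau> j)))"
  using assms by induction (auto intro: rational_on.intros)

lemma rational_on_continuous_map:
  assumes "rational_on U f"
  shows "continuous_map (subtopology (Euclidean_space n) U) euclideanreal f"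
  using assms
proof induction
  case (coord j)
  show ?case
    unfolding Euclidean_space_def
    by (intro continuous_map_from_subtopology) (metis UNIV_I continuous_map_product_coordinates)
next
  case (inverse f)
  then show ?case
    by (intro continuous_map_real_inverse) auto
qed (auto intro: continuous_intros)

text \<open>Differentiation introduces no new denominators: the only inverses in the derivative are
  those already present in \<open>f\<close>, so it is rational on the same \<open>U\<close>.\<close>

lemma rational_on_partial:
  assumes "rational_on U f"
  obtains f' where "rational_on U f'"
    and "\<And>x. x \<in> U \<Longrightarrow> ((\<lambda>t. f (x(i := t))) has_field_derivative f' x) (at (x i))"
proof -
  have "\<exists>f'. rational_on U f' \<and>
      (\<forall>x\<in>U. ((\<lambda>t. f (x(i := t))) has_field_derivative f' x) (at (x i)))"
    using assms
  proof induction
    case (const c)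
    show ?case by (intro exI[of _ "\<lambda>x. 0"]) (auto intro: rational_on.intros)
  next
    case (coord j)
    show ?case
      by (intro exI[of _ "\<lambda>x. if j = i then 1 else 0"])
         (auto intro: rational_on.intros simp: fun_upd_def)
  next
    case (add f g)
    then obtain f' g' where "rational_on U f'" "rational_on U g'"
      and d: "\<forall>x\<in>U. ((\<lambda>t. f (x(i := t))) has_field_derivative f' x) (at (x i))"
      "\<forall>x\<in>U. ((\<lambda>t. g (x(i := t))) has_field_derivative g' x) (at (x i))" by blast
    moreover have "((\<lambda>t. f (x(i := t)) + g (x(i := t))) has_field_derivative
        f' x + g' x) (at (x i))" if "x \<in> U" for x
      using DERIV_add[OF d(1)[rule_format, OF that] d(2)[rule_format, OF that]] .
    ultimately show ?case
      by (intro exI[of _ "\<lambda>x. f' x + g' x"]) (blast intro: rational_on.add)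
  next
    case (mult f g)
    then obtain f' g' where "rational_on U f'" "rational_on U g'"
      and d: "\<forall>x\<in>U. ((\<lambda>t. f (x(i := t))) has_field_derivative f' x) (at (x i))"
      "\<forall>x\<in>U. ((\<lambda>t. g (x(i := t))) has_field_derivative g' x) (at (x i))" by blast
    moreover have "((\<lambda>t. f (x(i := t)) * g (x(i := t))) has_field_derivative
        f' x * g x + g' x * f x) (at (x i))" if "x \<in> U" for x
      using DERIV_mult[OF d(1)[rule_format, OF that] d(2)[rule_format, OF that]] by simp
    moreover have "rational_on U (\<lambda>x. f' x * g x + g' x * f x)"
      by (intro rational_on.add rational_on.mult) fact+
    ultimately show ?case
      by (intro exI[of _ "\<lambda>x. f' x * g x + g' x * f x"]) blast
  next
    case (inverse f)
    then obtain f' where "rational_on U f'"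
      and d: "\<forall>x\<in>U. ((\<lambda>t. f (x(i := t))) has_field_derivative f' x) (at (x i))" by blast
    moreover have "((\<lambda>t. inverse (f (x(i := t)))) has_field_derivative
        - (inverse (f x) * f' x * inverse (f x))) (at (x i))" if "x \<in> U" for x
      using DERIV_inverse'[OF d[rule_format, OF that]] inverse.hyps(2)[OF that] by simp
    moreover have "rational_on U (\<lambda>x. - (inverse (f x) * f' x * inverse (f x)))"
      by (intro rational_on_uminus rational_on.mult rational_on.inverse inverse.hyps)
         (assumption | fact)+
    ultimately show ?case
      by (intro exI[of _ "\<lambda>x. - (inverse (f x) * f' x * inverse (f x))"]) blast
  qed
  then show thesis using that by blast
qed

text \<open>Partial derivatives are taken along coordinate lines, while functions are compared on
  \<open>U\<close> only. The line stays in \<open>U\<close> near \<open>x\<close>, which is enough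
  to transfer derivatives.\<close>

lemma openin_Euclidean_space_line:
  assumes U: "openin (Euclidean_space n) U" and x: "x \<in> U" and i: "i < n"
  shows "\<forall>\<^sub>F t in nhds (x i). x(i := t) \<in> U"
proof -
  \<comment> \<open>The cut-off puts the line in the form for which continuity is checked
    componentwise; since \<open>x\<close> vanishes from \<open>n\<close> on and
    \<open>i < n\<close>, it changes nothing.\<close>
  have "continuous_map euclideanreal (Euclidean_space n)
          (\<lambda>t k. if k < n then (x(i := t)) k else 0)"
    unfolding continuous_map_componentwise_Euclidean_space by (auto simp: fun_upd_def)
  moreover have "x \<in> topspace (Euclidean_space n)"
    using U x openin_subset by blast
  then have "(\<lambda>t k. if k < n then (x(i := t)) k else 0) = (\<lambda>t. x(i := t))"
    using i by (auto simp: topspace_Euclidean_space fun_eq_iff)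
  ultimately have "open {t. x(i := t) \<in> U}"
    using openin_continuous_map_preimage[of euclideanreal "Euclidean_space n" _ U] U by fastforce
  then show ?thesis
    using x by (force simp: eventually_nhds)
qed

text \<open>The extra function \<open>g\<close> is what makes the induction work:
  \<open>partial_deriv i g\<close> is known to be rational on \<open>U\<close> only, as
  \<open>deriv\<close> is uncontrolled elsewhere.\<close>

lemma rational_on_C_diff:
  assumes U: "openin (Euclidean_space n) U"
    and "rational_on U f" and "\<And>x. x \<in> U \<Longrightarrow> g x = f x"
  shows "C_diff k n U g"
  using assms(2,3)
proof (induction k arbitrary: f g)
  case 0
  have "continuous_map (subtopology (Euclidean_space n) U) euclideanreal g"
    by (rule continuous_map_eq[OF rational_on_continuous_map[OF 0(1)]]) (auto simp: 0)
  then show ?case by simp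
next
  case (Suc k)
  have c: "continuous_map (subtopology (Euclidean_space n) U) euclideanreal g"
    by (rule continuous_map_eq[OF rational_on_continuous_map[OF Suc(2)]]) (auto simp: Suc)
  have "(\<forall>x\<in>U. (\<lambda>t. g (x(i := t))) field_differentiable at (x i)) \<and>
      C_diff k n U (partial_deriv i g)" if i: "i < n" for i
  proof -
    obtain f' where f': "rational_on U f'"
      "\<And>x. x \<in> U \<Longrightarrow> ((\<lambda>t. f (x(i := t))) has_field_derivative f' x) (at (x i))"
      using rational_on_partial[OF Suc(2)] by metis
    have d: "((\<lambda>t. g (x(i := t))) has_field_derivative f' x) (at (x i))" if x: "x \<in> U" for x
    proof -
      have ev: "\<forall>\<^sub>F t in nhds (x i). g (x(i := t)) = f (x(i := t))"
        using openin_Euclidean_space_line[OF U x i] by eventually_elim (rule Suc.prems(2))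
      show ?thesis
        by (rule iffD2[OF DERIV_cong_ev[OF refl ev refl] f'(2)[OF x]])
    qed
    then have "partial_deriv i g x = f' x" if "x \<in> U" for x
      using that unfolding partial_deriv_def by (simp add: DERIV_imp_deriv)
    then show ?thesis
      using Suc.IH[OF f'(1)] d unfolding field_differentiable_def by blast
  qed
  then show ?case using c by simp
qed

text \<open>A single open set and a single extension serve all points of \<open>X\<close>.\<close>

lemma smooth_on_rational:
  assumes "openin (Euclidean_space n) U" and "X \<subseteq> U"
    and "f ` X \<subseteq> topspace (Euclidean_space m)"
    and "\<And>j. j < m \<Longrightarrow> rational_on U (\<lambda>x. g x j)"
    and "\<And>x j. x \<in> X \<Longrightarrow> j < m \<Longrightarrow> f x j = g x j"
  shows "smooth_on n m X f"
  unfolding smooth_on_def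
proof (intro conjI ballI)
  show "X \<subseteq> topspace (Euclidean_space n)"
    using assms(1,2) openin_subset by blast
  show "\<exists>U g. openin (Euclidean_space n) U \<and> x \<in> U \<and>
      (\<forall>j<m. \<forall>k. C_diff k n U (\<lambda>y. g y j)) \<and> (\<forall>y\<in>X \<inter> U. \<forall>j<m. g y j = f y j)"
    if "x \<in> X" for x
    using assms that rational_on_C_diff[OF assms(1,4)] by (intro exI[of _ U] exI[of _ g]) auto
qed (rule assms)

lemma openin_rational_nonzero:
  assumes "rational_on (topspace (Euclidean_space n)) g"
  shows "openin (Euclidean_space n) {x \<in> topspace (Euclidean_space n). g x \<noteq> 0}"
  using openin_continuous_map_preimage[OF rational_on_continuous_map[OF assms, of n], of "- {0}"]
  by (simp add: subtopology_topspace open_Compl)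

lemma rational_on_det:
  assumes "\<And>x. A x \<in> carrier_mat n n"
    and "\<And>i j. i < n \<Longrightarrow> j < n \<Longrightarrow> rational_on U (\<lambda>x. A x $$ (i, j))"
  shows "rational_on U (\<lambda>x. det (A x))"
proof -
  have "rational_on U (\<lambda>x. signof p * (\<Prod>i = 0..<n. A x $$ (i, p i)))"
    if "p permutes {0..<n}" for p
    using assms(2) permutes_in_image[OF that]
    by (intro rational_on.mult rational_on_prod rational_on.const) auto
  then show ?thesis
    unfolding det_def'[OF assms(1)] by (intro rational_on_sum) auto
qed

section \<open>Straightening a graph to a coordinate slice\<close>

lemma ex_permutes_lessThan_card:
  assumes "S \<subseteq> {..<n::nat}"
  obtains \<sigma> where "\<sigma> permutes {..<n}" and "\<sigma> ` {..<card S} = S"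
proof -
  let ?k = "card S"
  have fin: "finite S" using assms finite_subset by blast
  have k: "?k \<le> n" using card_mono[OF _ assms] by simp
  obtain h1 where h1: "bij_betw h1 {..<?k} S"
    using finite_same_card_bij[of "{..<?k}" S] fin by auto
  have "card ({..<n} - S) = card ({..<n} - {..<?k})"
    using k fin assms by (simp add: card_Diff_subset)
  then obtain h2 where h2: "bij_betw h2 ({..<n} - {..<?k}) ({..<n} - S)"
    using finite_same_card_bij[of "{..<n} - {..<?k}" "{..<n} - S"] by auto
  define \<sigma> where "\<sigma> i = (if i < ?k then h1 i else if i < n then h2 i else i)" for i
  have b1: "bij_betw \<sigma> {..<?k} S"
    using h1 by (subst bij_betw_cong[of _ \<sigma> h1]) (auto simp: \<sigma>_def)
  have b2: "bij_betw \<sigma> ({..<n} - {..<?k}) ({..<n} - S)"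
    using h2 by (subst bij_betw_cong[of _ \<sigma> h2]) (auto simp: \<sigma>_def)
  have "{..<?k} \<union> ({..<n} - {..<?k}) = {..<n}" "S \<union> ({..<n} - S) = {..<n}"
    using k assms by auto
  then have "bij_betw \<sigma> {..<n} {..<n}"
    using bij_betw_combine[OF b1 b2] by auto
  then have "\<sigma> permutes {..<n}"
    using k by (intro bij_imp_permutes) (auto simp: \<sigma>_def)
  then show thesis
    using that b1 by (auto simp: bij_betw_def)
qed

text \<open>A graph over the coordinates in \<open>S\<close> is straightened by subtracting the graph function
  from the other coordinates; a permutation then moves \<open>S\<close> to the front.\<close>

lemma graph_slice_chart:
  assumes W: "openin (Euclidean_space n) W" and S: "S \<subseteq> {..<n}"
    and f: "\<And>q. q \<in> {..<n} - S \<Longrightarrow> rational_on W (f q)"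
    and dep: "\<And>x y q. x \<in> W \<Longrightarrow> y \<in> topspace (Euclidean_space n) \<Longrightarrow>
      (\<And>s. s \<in> S \<Longrightarrow> y s = x s) \<Longrightarrow> y \<in> W \<and> (q \<in> {..<n} - S \<longrightarrow> f q y = f q x)"
  shows "\<exists>V \<phi>. openin (Euclidean_space n) V \<and> diffeo_on n W V \<phi> \<and>
    \<phi> ` {x \<in> W. \<forall>q\<in>{..<n} - S. x q = f q x} = V \<inter> topspace (Euclidean_space (card S))"
proof -
  obtain \<sigma> where \<sigma>: "\<sigma> permutes {..<n}" and \<sigma>S: "\<sigma> ` {..<card S} = S"
    using ex_permutes_lessThan_card[OF S] .
  define \<tau> where "\<tau> = inv_into UNIV \<sigma>"
  have \<sigma>\<tau> [simp]: "\<sigma> (\<tau> i) = i" "\<tau> (\<sigma> i) = i" for i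
    using permutes_inverses[OF \<sigma>] by (auto simp: \<tau>_def)
  have \<sigma>_ge: "\<sigma> i = i" and \<tau>_ge: "\<tau> i = i" if "i \<ge> n" for i
    using \<sigma> permutes_inv[OF \<sigma>] that by (auto simp: permutes_def \<tau>_def)
  have \<sigma>_S: "\<sigma> i \<in> S \<longleftrightarrow> i < card S" for i
    using \<sigma>S \<sigma>\<tau>(2) by (metis imageE imageI lessThan_iff)
  \<comment> \<open>The value 0 lets one formula serve all coordinates: those in \<open>S\<close>
    are merely permuted, and those from \<open>n\<close> on remain 0.\<close>
  define h where "h q x = (if q \<in> {..<n} - S then f q x else 0)" for q x
  define \<phi> where "\<phi> x k = x (\<sigma> k) - h (\<sigma> k) x" for x k
  define \<psi> where "\<psi> y q = y (\<tau> q) + h q (\<lambda>j. y (\<tau> j))" for y q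
  define V where "V = {y \<in> topspace (Euclidean_space n). (\<lambda>j. y (\<tau> j)) \<in> W}"
  have Wtop: "W \<subseteq> topspace (Euclidean_space n)" using W openin_subset by blast
  have top: "x \<in> topspace (Euclidean_space n) \<longleftrightarrow> (\<forall>i\<ge>n. x i = 0)" for x
    by (simp add: topspace_Euclidean_space)
  have h_S: "h q x = 0" if "q \<in> S" for q x using that by (simp add: h_def)
  have h_ge: "h q x = 0" if "q \<ge> n" for q x using that by (simp add: h_def)
  have h_dep: "y \<in> W" "h q y = h q x"
    if "x \<in> W" "y \<in> topspace (Euclidean_space n)" "\<And>s. s \<in> S \<Longrightarrow> y s = x s" for x y q
    using dep[OF that] by (auto simp: h_def)
  have h_rational: "rational_on W (h q)" for q
    using f[of q] by (cases "q \<in> {..<n} - S") (auto simp: h_def[abs_def] intro: rational_on.const)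
  have V: "openin (Euclidean_space n) V"
  proof -
    have "continuous_map (Euclidean_space n) euclideanreal (\<lambda>y. y j)" for j
      using rational_on_continuous_map[OF rational_on.coord, of n "topspace (Euclidean_space n)" j]
      by (simp add: subtopology_topspace)
    \<comment> \<open>As before, the cut-off only gives the map a componentwise form; it is harmless
      on the space because \<open>\<tau>\<close> fixes every index from \<open>n\<close> on.\<close>
    then have "continuous_map (Euclidean_space n) (Euclidean_space n) (\<lambda>y k. if k < n then y (\<tau> k) else 0)"
      unfolding continuous_map_componentwise_Euclidean_space by simp
    then have "openin (Euclidean_space n)
        {y \<in> topspace (Euclidean_space n). (\<lambda>k. if k < n then y (\<tau> k) else 0) \<in> W}"
      using W by (rule openin_continuous_map_preimage)
    moreover have "(\<lambda>k. if k < n then y (\<tau> k) else 0) = (\<lambda>k. y (\<tau> k))"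
      if "y \<in> topspace (Euclidean_space n)" for y
      using that \<tau>_ge by (auto simp: top fun_eq_iff)
    ultimately show ?thesis
      unfolding V_def by (smt (verit, ccfv_SIG) Collect_cong)
  qed
  have \<phi>_V: "\<phi> x \<in> V" and \<psi>\<phi>: "\<psi> (\<phi> x) = x" if x: "x \<in> W" for x
  proof -
    have eq: "(\<lambda>j. \<phi> x (\<tau> j)) = (\<lambda>j. x j - h j x)" by (simp add: \<phi>_def)
    have y: "(\<lambda>j. x j - h j x) \<in> topspace (Euclidean_space n)"
      using x Wtop by (auto simp: top h_ge)
    \<comment> \<open>Subtracting \<open>h\<close> leaves the coordinates in \<open>S\<close> alone,
      so \<open>h\<close> takes the same values here as at \<open>x\<close>, and
      \<open>\<psi>\<close> adds back exactly what \<open>\<phi>\<close> subtracted.\<close>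
    have "(\<lambda>j. x j - h j x) \<in> W" and "h q (\<lambda>j. x j - h j x) = h q x" for q
      using h_dep[OF x y] by (auto simp: h_S)
    then show "\<phi> x \<in> V" "\<psi> (\<phi> x) = x"
      using x Wtop unfolding V_def \<psi>_def eq
      by (auto simp: top \<phi>_def \<sigma>_ge h_ge)
  qed
  have \<psi>_W: "\<psi> y \<in> W" and h\<psi>: "h q (\<psi> y) = h q (\<lambda>j. y (\<tau> j))" and \<phi>\<psi>: "\<phi> (\<psi> y) = y"
    if y: "y \<in> V" for y q
  proof -
    have W: "(\<lambda>j. y (\<tau> j)) \<in> W" and "y \<in> topspace (Euclidean_space n)"
      using y by (auto simp: V_def)
    then have "\<psi> y \<in> topspace (Euclidean_space n)"
      by (auto simp: top \<psi>_def \<tau>_ge h_ge)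
    then have d: "\<psi> y \<in> W" "h q (\<psi> y) = h q (\<lambda>j. y (\<tau> j))" for q
      using h_dep[OF W] by (auto simp: h_S \<psi>_def)
    then show "\<psi> y \<in> W" "h q (\<psi> y) = h q (\<lambda>j. y (\<tau> j))" "\<phi> (\<psi> y) = y"
      unfolding \<phi>_def d by (auto simp: \<psi>_def)
  qed
  have bij: "bij_betw \<phi> W V"
    by (rule bij_betw_byWitness[of _ \<psi>]) (use \<phi>_V \<psi>\<phi> \<psi>_W \<phi>\<psi> in auto)
  have inv: "inv_into W \<phi> y = \<psi> y" if "y \<in> V" for y
    using inv_into_f_eq[of \<phi> W "\<psi> y" y] bij \<psi>_W[OF that] \<phi>\<psi>[OF that] by (simp add: bij_betw_def)
  have "smooth_on n n W \<phi>"
  proof (rule smooth_on_rational[OF W, where g = \<phi>])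
    show "\<phi> ` W \<subseteq> topspace (Euclidean_space n)" using \<phi>_V by (auto simp: V_def)
    show "rational_on W (\<lambda>x. \<phi> x j)" for j
      unfolding \<phi>_def by (intro rational_on_diff rational_on.coord h_rational)
  qed auto
  moreover have "smooth_on n n V (inv_into W \<phi>)"
  proof (rule smooth_on_rational[OF V, where g = \<psi>])
    show "inv_into W \<phi> ` V \<subseteq> topspace (Euclidean_space n)" using inv \<psi>_W Wtop by auto
    show "rational_on V (\<lambda>x. \<psi> x j)" for j
      unfolding \<psi>_def
      by (intro rational_on.add rational_on.coord rational_on_subst[OF h_rational]) (simp add: V_def)
  qed (auto simp: inv)
  moreover have "\<phi> ` {x \<in> W. \<forall>q\<in>{..<n} - S. x q = f q x} = V \<inter> topspace (Euclidean_space (card S))"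
  proof (intro equalityI subsetI)
    fix y assume "y \<in> \<phi> ` {x \<in> W. \<forall>q\<in>{..<n} - S. x q = f q x}"
    then obtain x where x: "x \<in> W" "\<forall>q\<in>{..<n} - S. x q = f q x" and y: "y = \<phi> x" by auto
    \<comment> \<open>From \<open>card S\<close> on, \<open>\<sigma> k\<close> lies outside
      \<open>S\<close>: below \<open>n\<close> the graph equation makes the difference vanish, and
      beyond that the point itself is 0.\<close>
    have "y k = 0" if "k \<ge> card S" for k
    proof (cases "\<sigma> k < n")
      case True
      then show ?thesis using x that \<sigma>_S[of k] by (simp add: y \<phi>_def h_def)
    next
      case False
      then show ?thesis using x(1) Wtop by (auto simp: y \<phi>_def h_ge top)
    qed
    then show "y \<in> V \<inter> topspace (Euclidean_space (card S))"
      using \<phi>_V[OF x(1)] y by (simp add: topspace_Euclidean_space)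
  next
    fix y assume "y \<in> V \<inter> topspace (Euclidean_space (card S))"
    then have y: "y \<in> V" "\<And>k. k \<ge> card S \<Longrightarrow> y k = 0" by (auto simp: topspace_Euclidean_space)
    have "\<psi> y q = f q (\<psi> y)" if "q \<in> {..<n} - S" for q
    proof -
      have "y (\<tau> q) = 0" using that \<sigma>_S[of "\<tau> q"] by (intro y(2)) simp
      then have "\<psi> y q = h q (\<psi> y)" by (simp add: h\<psi>[OF y(1)] \<psi>_def)
      then show ?thesis using that by (simp add: h_def)
    qed
    then show "y \<in> \<phi> ` {x \<in> W. \<forall>q\<in>{..<n} - S. x q = f q x}"
      using \<psi>_W[OF y(1)] \<phi>\<psi>[OF y(1)] by (intro image_eqI[of _ _ "\<psi> y"]) auto
  qed
  ultimately show ?thesis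
    using V bij unfolding diffeo_on_def by blast
qed

section \<open>Kronecker products\<close>

abbreviation square_mats :: "nat list \<Rightarrow> real mat list \<Rightarrow> bool" where
  "square_mats ns As \<equiv> list_all2 (\<lambda>n A. A \<in> carrier_mat n n) ns As"

lemma sum_div_mod:
  fixes f :: "nat \<Rightarrow> nat \<Rightarrow> 'a::comm_monoid_add"
  shows "(\<Sum>l<n * m. f (l div m) (l mod m)) = (\<Sum>p<n. \<Sum>q<m. f p q)"
proof -
  have "p * m + q < n * m" if "p < n" "q < m" for p q
  proof -
    have "p * m + q < Suc p * m" using that by simp
    also have "\<dots> \<le> n * m" using that by (intro mult_le_mono1) simp
    finally show ?thesis .
  qed
  then show ?thesis
    unfolding sum.cartesian_product
    by (intro sum.reindex_bij_witness[of _ "\<lambda>(p, q). p * m + q" "\<lambda>l. (l div m, l mod m)"])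
       (auto simp: less_mult_imp_div_less intro!: mod_less_divisor gr0I)
qed

lemma index_mult_mat_sum:
  assumes "A \<in> carrier_mat a b" "B \<in> carrier_mat b c" "i < a" "j < c"
  shows "(A * B) $$ (i, j) = (\<Sum>l<b. A $$ (i, l) * B $$ (l, j))"
  using assms by (simp add: scalar_prod_def lessThan_atLeast0)

lemma dim_kron [simp]:
  "dim_row (kron A B) = dim_row A * dim_row B"
  "dim_col (kron A B) = dim_col A * dim_col B"
  by (simp_all add: kron_def)

lemma kron_carrier:
  "A \<in> carrier_mat a b \<Longrightarrow> B \<in> carrier_mat c d \<Longrightarrow> kron A B \<in> carrier_mat (a * c) (b * d)"
  by auto

lemma index_kron:
  "i < dim_row A * dim_row B \<Longrightarrow> j < dim_col A * dim_col B \<Longrightarrow>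
    kron A B $$ (i, j) = A $$ (i div dim_row B, j div dim_col B) * B $$ (i mod dim_row B, j mod dim_col B)"
  by (simp add: kron_def)

lemma div_mod_less:
  fixes i :: nat
  assumes "i < a * b"
  shows "i div b < a" and "i mod b < b"
  using assms by (auto simp: less_mult_imp_div_less intro!: mod_less_divisor gr0I)

text \<open>The summation index splits into quotient and remainder, and the summand separates
  accordingly, so the sum is a product of two matrix-product entries.\<close>

lemma kron_mult:
  assumes "A \<in> carrier_mat a b" "A' \<in> carrier_mat b c" "B \<in> carrier_mat d e" "B' \<in> carrier_mat e f"
  shows "kron A B * kron A' B' = kron (A * A') (B * B')"
proof (rule eq_matI)
  fix i j assume "i < dim_row (kron (A * A') (B * B'))" "j < dim_col (kron (A * A') (B * B'))"
  then have i: "i < a * d" and j: "j < c * f" using assms by auto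
  have "(kron A B * kron A' B') $$ (i, j) = (\<Sum>l<b * e. kron A B $$ (i, l) * kron A' B' $$ (l, j))"
    using assms i j by (intro index_mult_mat_sum[where a = "a * d" and c = "c * f"]) auto
  also have "\<dots> = (\<Sum>l<b * e. A $$ (i div d, l div e) * B $$ (i mod d, l mod e) *
      (A' $$ (l div e, j div f) * B' $$ (l mod e, j mod f)))"
    using assms i j by (intro sum.cong) (auto simp: index_kron)
  also have "\<dots> = (\<Sum>p<b. \<Sum>q<e. A $$ (i div d, p) * B $$ (i mod d, q) *
      (A' $$ (p, j div f) * B' $$ (q, j mod f)))"
    by (rule sum_div_mod)
  also have "\<dots> = (\<Sum>p<b. A $$ (i div d, p) * A' $$ (p, j div f)) *
      (\<Sum>q<e. B $$ (i mod d, q) * B' $$ (q, j mod f))"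
    by (simp add: sum_product mult_ac)
  also have "\<dots> = kron (A * A') (B * B') $$ (i, j)"
    using assms i j div_mod_less[OF i] div_mod_less[OF j]
    by (simp add: index_kron scalar_prod_def lessThan_atLeast0)
  finally show "(kron A B * kron A' B') $$ (i, j) = kron (A * A') (B * B') $$ (i, j)" .
qed (use assms in auto)

lemma kron_one: "kron (1\<^sub>m n) (1\<^sub>m m) = 1\<^sub>m (n * m)"
proof (rule eq_matI)
  fix i j assume "i < dim_row (1\<^sub>m (n * m))" "j < dim_col (1\<^sub>m (n * m))"
  then have i: "i < n * m" and j: "j < n * m" by auto
  have "i div m = j div m \<and> i mod m = j mod m \<longleftrightarrow> i = j"
    by (metis div_mult_mod_eq)
  then show "kron (1\<^sub>m n) (1\<^sub>m m) $$ (i, j) = 1\<^sub>m (n * m) $$ (i, j)"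
    using i j div_mod_less[OF i] div_mod_less[OF j] by (auto simp: index_kron)
qed auto

lemma kron_add_left:
  assumes "A \<in> carrier_mat a b" "A' \<in> carrier_mat a b"
  shows "kron (A + A') B = kron A B + kron A' B"
  using assms by (intro eq_matI) (auto simp: index_kron div_mod_less algebra_simps)

lemma kron_add_right:
  assumes "B \<in> carrier_mat a b" "B' \<in> carrier_mat a b"
  shows "kron A (B + B') = kron A B + kron A B'"
  using assms by (intro eq_matI) (auto simp: index_kron div_mod_less algebra_simps)

lemma kron_diff_left:
  assumes "A \<in> carrier_mat a b" "A' \<in> carrier_mat a b"
  shows "kron (A - A') B = kron A B - kron A' B"
  using assms by (intro eq_matI) (auto simp: index_kron div_mod_less algebra_simps minus_mat_def)

lemma kron_diff_right:
  assumes "B \<in> carrier_mat a b" "B' \<in> carrier_mat a b"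
  shows "kron A (B - B') = kron A B - kron A B'"
  using assms by (intro eq_matI) (auto simp: index_kron div_mod_less algebra_simps minus_mat_def)

lemma kron_smult_left: "kron (c \<cdot>\<^sub>m A) B = c \<cdot>\<^sub>m kron A B"
  by (intro eq_matI) (auto simp: index_kron div_mod_less)

lemma kron_smult_right: "kron A (c \<cdot>\<^sub>m B) = c \<cdot>\<^sub>m kron A B"
  by (intro eq_matI) (auto simp: index_kron div_mod_less)

lemma kron_list_Nil [simp]: "kron_list [] = 1\<^sub>m 1"
  and kron_list_Cons [simp]: "kron_list (A # As) = kron A (kron_list As)"
  by (simp_all add: kron_list_def)

lemma kron_list_carrier:
  "square_mats ns As \<Longrightarrow> kron_list As \<in> carrier_mat (prod_list ns) (prod_list ns)"
  by (induction ns As rule: list_all2_induct) (auto simp: kron_carrier)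

lemma kron_list_one: "kron_list (map 1\<^sub>m ns) = 1\<^sub>m (prod_list ns)"
  by (induction ns) (auto simp: kron_one)

lemma kron_list_mult:
  assumes "square_mats ns As" "square_mats ns Bs"
  shows "kron_list As * kron_list Bs = kron_list (map2 (*) As Bs)"
  using assms
proof (induction ns As arbitrary: Bs rule: list_all2_induct)
  case (Cons n ns A As)
  then obtain B Bs' where [simp]: "Bs = B # Bs'" and B: "B \<in> carrier_mat n n" and Bs: "square_mats ns Bs'"
    by (auto simp: list_all2_Cons1)
  show ?case
    using kron_mult[OF Cons.hyps(1) B kron_list_carrier[OF Cons.hyps(2)] kron_list_carrier[OF Bs]]
      Cons.IH[OF Bs] by simp
qed auto

section \<open>Laplacian sums\<close>

lemma finsum_mat:
  assumes "finite I" and "\<And>i. i \<in> I \<Longrightarrow> f i \<in> carrier_mat n m"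
  shows "finsum (module_mat TYPE(real) n m) f I = mat n m (\<lambda>p. \<Sum>i\<in>I. f i $$ p)"
proof -
  interpret abelian_group "module_mat TYPE(real) n m" by (rule abelian_group_mat)
  show ?thesis
    using assms
  proof induction
    case empty
    show ?case by (auto simp: module_mat_simps)
  next
    case (insert i I)
    then have "finsum (module_mat TYPE(real) n m) f (insert i I) =
        f i + finsum (module_mat TYPE(real) n m) f I"
      by (subst finsum_insert) (auto simp: module_mat_simps)
    with insert show ?case by (auto intro!: eq_matI)
  qed
qed

lemma laplacian_sum_Nil [simp]: "laplacian_sum [] As = 0\<^sub>m 1 1"
  by (auto simp: laplacian_sum_def finsum_mat intro!: eq_matI)

text \<open>Splitting off the first factor leaves a Kronecker sum of two matrices. This recursion
  carries all later inductions on Laplacian sums.\<close>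

lemma laplacian_sum_Cons:
  assumes A: "A \<in> carrier_mat n n" and As: "square_mats ns As"
  shows "laplacian_sum (n # ns) (A # As) =
    kron A (1\<^sub>m (prod_list ns)) + kron (1\<^sub>m n) (laplacian_sum ns As)"
proof -
  let ?P = "prod_list ns" and ?f = "\<lambda>i. kron_list ((map 1\<^sub>m ns)[i := As ! i])"
  have sq: "square_mats ns ((map 1\<^sub>m ns)[i := As ! i])" if "i < length ns" for i
    using As that by (auto simp: list_all2_conv_all_nth nth_list_update)
  have sq': "square_mats (n # ns) ((map 1\<^sub>m (n # ns))[i := (A # As) ! i])" if "i < length (n # ns)" for i
    using A As that by (auto simp: list_all2_conv_all_nth nth_list_update nth_Cons split: nat.splits)
  have L: "laplacian_sum ns As = mat ?P ?P (\<lambda>p. \<Sum>i<length ns. ?f i $$ p)"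
    unfolding laplacian_sum_def using kron_list_carrier[OF sq] by (intro finsum_mat) auto
  have "laplacian_sum (n # ns) (A # As) = mat (n * ?P) (n * ?P)
      (\<lambda>p. \<Sum>i<length (n # ns). kron_list ((map 1\<^sub>m (n # ns))[i := (A # As) ! i]) $$ p)"
    unfolding laplacian_sum_def using kron_list_carrier[OF sq'] by (subst finsum_mat) auto
  \<comment> \<open>The summand with index 0 has \<open>A\<close> in front of identities; each other
    one is a summand of the tail with an identity in front.\<close>
  also have "\<dots> = mat (n * ?P) (n * ?P)
      (\<lambda>p. kron A (1\<^sub>m ?P) $$ p + (\<Sum>i<length ns. kron (1\<^sub>m n) (?f i) $$ p))"
    by (simp add: sum.lessThan_Suc_shift kron_list_one del: sum.lessThan_Suc)
  also have "\<dots> = kron A (1\<^sub>m ?P) + kron (1\<^sub>m n) (laplacian_sum ns As)"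
  proof (rule eq_matI)
    fix i j assume "i < dim_row (kron A (1\<^sub>m ?P) + kron (1\<^sub>m n) (laplacian_sum ns As))"
      "j < dim_col (kron A (1\<^sub>m ?P) + kron (1\<^sub>m n) (laplacian_sum ns As))"
    then have i: "i < n * ?P" and j: "j < n * ?P" by (auto simp: L)
    have "kron (1\<^sub>m n) (?f k) $$ (i, j) = 1\<^sub>m n $$ (i div ?P, j div ?P) * ?f k $$ (i mod ?P, j mod ?P)"
      if "k < length ns" for k
      using kron_list_carrier[OF sq[OF that]] i j by (subst index_kron) auto
    then show "mat (n * ?P) (n * ?P)
      (\<lambda>p. kron A (1\<^sub>m ?P) $$ p + (\<Sum>i<length ns. kron (1\<^sub>m n) (?f i) $$ p)) $$ (i, j) =
      (kron A (1\<^sub>m ?P) + kron (1\<^sub>m n) (laplacian_sum ns As)) $$ (i, j)"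
      using i j div_mod_less[OF i] div_mod_less[OF j]
      by (simp add: L index_kron sum_distrib_left del: index_one_mat(1))
  qed (use A in \<open>auto simp: L\<close>)
  finally show ?thesis .
qed

lemma laplacian_sum_carrier:
  "square_mats ns As \<Longrightarrow> laplacian_sum ns As \<in> carrier_mat (prod_list ns) (prod_list ns)"
  by (induction ns As rule: list_all2_induct)
     (auto simp: laplacian_sum_Cons intro!: add_carrier_mat kron_carrier)

lemma laplacian_sum_add:
  assumes "square_mats ns As" "square_mats ns Bs"
  shows "laplacian_sum ns As + laplacian_sum ns Bs = laplacian_sum ns (map2 (+) As Bs)"
  using assms
proof (induction ns As arbitrary: Bs rule: list_all2_induct)
  case (Cons n ns A As)
  then obtain B Bs' where [simp]: "Bs = B # Bs'" and B: "B \<in> carrier_mat n n" and Bs: "square_mats ns Bs'"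
    by (auto simp: list_all2_Cons1)
  let ?I = "1\<^sub>m (prod_list ns)"
  have c: "laplacian_sum ns As \<in> carrier_mat (prod_list ns) (prod_list ns)"
    "laplacian_sum ns Bs' \<in> carrier_mat (prod_list ns) (prod_list ns)"
    using Cons.hyps Bs laplacian_sum_carrier by auto
  have sq: "square_mats ns (map2 (+) As Bs')"
    using Cons.hyps(2) Bs by (auto simp: list_all2_conv_all_nth)
  have "laplacian_sum (n # ns) (map2 (+) (A # As) Bs) =
      (kron A ?I + kron B ?I) + (kron (1\<^sub>m n) (laplacian_sum ns As) + kron (1\<^sub>m n) (laplacian_sum ns Bs'))"
    using Cons.hyps B Bs sq c
    by (simp add: laplacian_sum_Cons Cons.IH[symmetric] kron_add_left kron_add_right)
  also have "\<dots> = laplacian_sum (n # ns) (A # As) + laplacian_sum (n # ns) Bs"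
    using Cons.hyps B Bs c by (auto simp: laplacian_sum_Cons intro!: eq_matI)
  finally show ?case ..
qed auto

lemma laplacian_sum_smult:
  assumes "square_mats ns As"
  shows "c \<cdot>\<^sub>m laplacian_sum ns As = laplacian_sum ns (map ((\<cdot>\<^sub>m) c) As)"
  using assms
proof (induction ns As rule: list_all2_induct)
  case (Cons n ns A As)
  have sq: "square_mats ns (map ((\<cdot>\<^sub>m) c) As)"
    using Cons.hyps(2) by (auto simp: list_all2_conv_all_nth)
  have L: "laplacian_sum ns As \<in> carrier_mat (prod_list ns) (prod_list ns)"
    using Cons.hyps laplacian_sum_carrier by auto
  show ?case
    using Cons.hyps sq L
    by (simp add: laplacian_sum_Cons Cons.IH[symmetric] kron_smult_left kron_smult_right)
       (auto intro!: eq_matI simp: algebra_simps)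
qed auto

lemma laplacian_sum_bracket:
  assumes "square_mats ns As" "square_mats ns Bs"
  shows "laplacian_sum ns As * laplacian_sum ns Bs - laplacian_sum ns Bs * laplacian_sum ns As =
    laplacian_sum ns (map2 (\<lambda>A B. A * B - B * A) As Bs)"
  using assms
proof (induction ns As arbitrary: Bs rule: list_all2_induct)
  case (Cons n ns A As)
  then obtain B Bs' where [simp]: "Bs = B # Bs'" and B: "B \<in> carrier_mat n n" and Bs: "square_mats ns Bs'"
    by (auto simp: list_all2_Cons1)
  let ?P = "prod_list ns" and ?L = "laplacian_sum ns As" and ?M = "laplacian_sum ns Bs'"
  note A = Cons.hyps(1)
  have L: "?L \<in> carrier_mat ?P ?P" and M: "?M \<in> carrier_mat ?P ?P"
    using Cons.hyps Bs laplacian_sum_carrier by auto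
  have sq: "square_mats ns (map2 (\<lambda>A B. A * B - B * A) As Bs')"
    using Cons.hyps(2) Bs
    by (auto simp: list_all2_conv_all_nth intro!: minus_carrier_mat mult_carrier_mat)
  \<comment> \<open>The mixed terms are \<open>kron C K'\<close> and \<open>kron D K\<close>.
    Exchanging the two factors only exchanges these terms, so they cancel in the bracket.\<close>
  have prod: "(kron C (1\<^sub>m ?P) + kron (1\<^sub>m n) K) * (kron D (1\<^sub>m ?P) + kron (1\<^sub>m n) K') =
      kron (C * D) (1\<^sub>m ?P) + kron C K' + (kron D K + kron (1\<^sub>m n) (K * K'))"
    if [simp]: "C \<in> carrier_mat n n" "D \<in> carrier_mat n n" "K \<in> carrier_mat ?P ?P" "K' \<in> carrier_mat ?P ?P"
    for C D K K'
  proof -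
    have k: "kron X Y \<in> carrier_mat (n * ?P) (n * ?P)"
      if "X \<in> carrier_mat n n" "Y \<in> carrier_mat ?P ?P" for X Y
      using that by (rule kron_carrier)
    show ?thesis
      using k by (simp add: add_mult_distrib_mat[OF k k add_carrier_mat[OF k]]
          mult_add_distrib_mat[OF k k k] kron_mult[of _ n n _ n _ ?P ?P _ ?P]
          right_mult_one_mat[of _ n n] left_mult_one_mat[of _ n n]
          right_mult_one_mat[of _ ?P ?P] left_mult_one_mat[of _ ?P ?P])
  qed
  have "laplacian_sum (n # ns) (A # As) * laplacian_sum (n # ns) Bs -
      laplacian_sum (n # ns) Bs * laplacian_sum (n # ns) (A # As) =
      (kron (A * B) (1\<^sub>m ?P) - kron (B * A) (1\<^sub>m ?P)) + (kron (1\<^sub>m n) (?L * ?M) - kron (1\<^sub>m n) (?M * ?L))"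
    using A B L M Bs Cons.hyps by (auto simp: laplacian_sum_Cons prod intro!: eq_matI)
  also have "\<dots> = laplacian_sum (n # ns) (map2 (\<lambda>A B. A * B - B * A) (A # As) Bs)"
    using A B L M Bs sq Cons.IH[OF Bs, symmetric]
    by (simp add: laplacian_sum_Cons kron_diff_left[of _ n n] kron_diff_right[of _ ?P ?P] minus_carrier_mat)
  finally show ?case .
qed auto

section \<open>The matrix exponential\<close>

lemma mat_exp_carrier: "A \<in> carrier_mat n n \<Longrightarrow> mat_exp A \<in> carrier_mat n n"
  by (simp add: mat_exp_def)

lemma index_mat_exp:
  "A \<in> carrier_mat n n \<Longrightarrow> i < n \<Longrightarrow> j < n \<Longrightarrow>
    mat_exp A $$ (i, j) = (\<Sum>k. (A ^\<^sub>m k) $$ (i, j) / fact k)"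
  by (simp add: mat_exp_def)

lemma smult_pow_mat:
  fixes A :: "real mat"
  assumes "A \<in> carrier_mat n n"
  shows "(c \<cdot>\<^sub>m A) ^\<^sub>m k = c ^ k \<cdot>\<^sub>m (A ^\<^sub>m k)"
proof (induction k)
  case (Suc k)
  have "A ^\<^sub>m k \<in> carrier_mat n n" using assms by simp
  then show ?case
    using assms Suc
    by (simp add: mult_smult_distrib[of _ n n _ n] mult_smult_assoc_mat[of _ n n _ n])
       (auto intro!: eq_matI)
qed (use assms in \<open>auto intro!: eq_matI\<close>)

text \<open>The power series in \<open>t\<close> of an entry of \<open>mat_exp (t \<cdot>\<^sub>m A)\<close> converges at \<open>t = 2\<close>,
  hence absolutely at \<open>t = 1\<close>.\<close>

lemma summable_abs_mat_exp_entry: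
  fixes A :: "real mat"
  assumes A: "A \<in> carrier_mat n n" and ij: "i < n" "j < n"
  shows "summable (\<lambda>k. \<bar>(A ^\<^sub>m k) $$ (i, j) / fact k\<bar>)"
proof -
  have "summable (\<lambda>k. ((2 \<cdot>\<^sub>m A) ^\<^sub>m k) $$ (i, j) / fact k)"
    using A ij by (intro summable_mat_exp_entry) auto
  moreover have "((2 \<cdot>\<^sub>m A) ^\<^sub>m k) $$ (i, j) / fact k = (A ^\<^sub>m k) $$ (i, j) / fact k * 2 ^ k" for k
    using ij A by (simp add: smult_pow_mat[OF A])
  ultimately have "summable (\<lambda>k. norm ((A ^\<^sub>m k) $$ (i, j) / fact k * 1 ^ k))"
    by (intro powser_insidea[where x = 2]) auto
  then show ?thesis by simp
qed

text \<open>Sizes and positions of the two entries are independent: the lemma serves the product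
  with the exponential of \<open>- A\<close> as well as Kronecker products of different
  sizes.\<close>

lemma mat_exp_entry_Cauchy_product:
  assumes "A \<in> carrier_mat n n" "i < n" "j < n" and "B \<in> carrier_mat m m" "i' < m" "j' < m"
  shows "(\<lambda>k. \<Sum>p\<le>k. (A ^\<^sub>m p) $$ (i, j) / fact p * ((B ^\<^sub>m (k - p)) $$ (i', j') / fact (k - p)))
    sums (mat_exp A $$ (i, j) * mat_exp B $$ (i', j'))"
  using Cauchy_product_sums[OF summable_abs_mat_exp_entry[OF assms(1-3), folded real_norm_def]
      summable_abs_mat_exp_entry[OF assms(4-6), folded real_norm_def]] assms
  by (simp add: index_mat_exp)

lemma pow_mat_add:
  fixes A :: "'a::semiring_1 mat"
  assumes "A \<in> carrier_mat n n"
  shows "A ^\<^sub>m (p + q) = A ^\<^sub>m p * A ^\<^sub>m q"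
proof (induction q)
  case (Suc q)
  then show ?case
    using assms by (simp add: assoc_mult_mat[of _ n n _ n _ n])
qed (use assms in auto)

text \<open>Exponentials are nonsingular because of this explicit inverse. The part of degree
  \<open>k\<close> in the product of both series is (1 - 1)^k / k! times
  \<open>A ^\<^sub>m k\<close>, so only \<open>k = 0\<close> survives.\<close>

lemma mat_exp_inverse:
  assumes A: "A \<in> carrier_mat n n"
  shows "mat_exp A * mat_exp (- A) = 1\<^sub>m n"
proof (rule eq_matI)
  fix i j assume "i < dim_row (1\<^sub>m n :: real mat)" "j < dim_col (1\<^sub>m n :: real mat)"
  then have ij: "i < n" "j < n" by auto
  have A': "- A \<in> carrier_mat n n" using A by simp
  have neg: "((- A) ^\<^sub>m k) $$ (l, j) = (- 1) ^ k * (A ^\<^sub>m k) $$ (l, j)" if "l < n" for l k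
  proof -
    have "- A = (- 1) \<cdot>\<^sub>m A" by (intro eq_matI) auto
    then show ?thesis
      using that ij A by (simp add: smult_pow_mat[OF A])
  qed
  have entry: "(\<Sum>l<n. \<Sum>p\<le>k. (A ^\<^sub>m p) $$ (i, l) / fact p * (((- A) ^\<^sub>m (k - p)) $$ (l, j) / fact (k - p)))
      = (if k = 0 then 1\<^sub>m n $$ (i, j) else 0)" for k
  proof -
    have prod: "(\<Sum>l<n. (A ^\<^sub>m p) $$ (i, l) * (A ^\<^sub>m (k - p)) $$ (l, j)) = (A ^\<^sub>m k) $$ (i, j)"
      if "p \<le> k" for p
      using that index_mult_mat_sum[OF pow_carrier_mat[OF A] pow_carrier_mat[OF A] ij]
        pow_mat_add[OF A, of p "k - p"] by simp
    have "(\<Sum>l<n. \<Sum>p\<le>k. (A ^\<^sub>m p) $$ (i, l) / fact p * (((- A) ^\<^sub>m (k - p)) $$ (l, j) / fact (k - p)))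
      = (\<Sum>p\<le>k. \<Sum>l<n. (- 1) ^ (k - p) / (fact p * fact (k - p)) * ((A ^\<^sub>m p) $$ (i, l) * (A ^\<^sub>m (k - p)) $$ (l, j)))"
      by (subst sum.swap) (auto intro!: sum.cong simp: neg)
    also have "\<dots> = (\<Sum>p\<le>k. (- 1) ^ (k - p) / (fact p * fact (k - p)) * (A ^\<^sub>m k) $$ (i, j))"
      by (intro sum.cong refl) (simp only: sum_distrib_left[symmetric] prod atMost_iff)
    also have "\<dots> = (\<Sum>p\<le>k. of_nat (k choose p) * 1 ^ p * (- 1) ^ (k - p)) * (A ^\<^sub>m k) $$ (i, j) / fact k"
      unfolding sum_distrib_right sum_divide_distrib
      by (intro sum.cong refl) (simp add: binomial_fact)
    also have "\<dots> = (1 + (- 1)) ^ k * (A ^\<^sub>m k) $$ (i, j) / fact k"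
      by (simp only: binomial_ring)
    finally show ?thesis using A by (cases k) auto
  qed
  have "(\<lambda>k. \<Sum>l<n. \<Sum>p\<le>k. (A ^\<^sub>m p) $$ (i, l) / fact p * (((- A) ^\<^sub>m (k - p)) $$ (l, j) / fact (k - p)))
    sums (\<Sum>l<n. mat_exp A $$ (i, l) * mat_exp (- A) $$ (l, j))"
    using A A' ij by (intro sums_sum mat_exp_entry_Cauchy_product) auto
  moreover have "(\<lambda>k. if k = 0 then 1\<^sub>m n $$ (i, j) else 0 :: real) sums (1\<^sub>m n $$ (i, j))"
    using sums_single[of 0 "\<lambda>_. 1\<^sub>m n $$ (i, j)"] by (simp add: eq_commute)
  ultimately have "(\<Sum>l<n. mat_exp A $$ (i, l) * mat_exp (- A) $$ (l, j)) = 1\<^sub>m n $$ (i, j)"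
    unfolding entry by (rule sums_unique2)
  then show "(mat_exp A * mat_exp (- A)) $$ (i, j) = 1\<^sub>m n $$ (i, j)"
    by (simp only: index_mult_mat_sum[OF mat_exp_carrier[OF A] mat_exp_carrier[OF A'] ij])
qed (use mat_exp_carrier[OF A] mat_exp_carrier[of "- A" n] A in auto)

section \<open>Exponential of a Kronecker sum\<close>

lemma sum_binomial_Suc:
  fixes g :: "nat \<Rightarrow> nat \<Rightarrow> 'a::comm_semiring_1"
  shows "(\<Sum>p\<le>Suc k. of_nat (Suc k choose p) * g p (Suc k - p)) =
    (\<Sum>p\<le>k. of_nat (k choose p) * (g (Suc p) (k - p) + g p (Suc (k - p))))"
proof -
  \<comment> \<open>The added term \<open>p = Suc k\<close> has coefficient
    \<open>k choose Suc k\<close>, which is 0; the shifted sums then combine by Pascal's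
    rule.\<close>
  have "(\<Sum>p\<le>k. of_nat (k choose p) * g p (Suc (k - p))) =
      (\<Sum>p\<le>Suc k. of_nat (k choose p) * g p (Suc k - p))"
    by (simp add: Suc_diff_le binomial_eq_0)
  then show ?thesis
    by (simp add: sum.atMost_Suc_shift sum.distrib algebra_simps del: sum.atMost_Suc)
qed

text \<open>The binomial theorem for the commuting matrices A \<otimes> 1 and 1 \<otimes> B.
  Multiplying by the sum on the right raises one of the two exponents; row \<open>i\<close> stays
  fixed while \<open>j\<close> runs through all columns, hence the generalization over
  \<open>j\<close> alone.\<close>

lemma index_kron_sum_pow:
  assumes A: "A \<in> carrier_mat n n" and B: "B \<in> carrier_mat m m"
    and i: "i < n * m" and j: "j < n * m"
  shows "((kron A (1\<^sub>m m) + kron (1\<^sub>m n) B) ^\<^sub>m k) $$ (i, j) =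
    (\<Sum>p\<le>k. of_nat (k choose p) * kron (A ^\<^sub>m p) (B ^\<^sub>m (k - p)) $$ (i, j))"
  using j
proof (induction k arbitrary: j)
  case 0
  then show ?case using A B i by (simp add: kron_one)
next
  case (Suc k)
  let ?L = "kron A (1\<^sub>m m) + kron (1\<^sub>m n) B"
  have K: "kron X Y \<in> carrier_mat (n * m) (n * m)"
    if "X \<in> carrier_mat n n" "Y \<in> carrier_mat m m" for X Y
    using that by (rule kron_carrier)
  have L: "?L \<in> carrier_mat (n * m) (n * m)" using A B by (intro add_carrier_mat K) auto
  have pA: "A ^\<^sub>m q \<in> carrier_mat n n" and pB: "B ^\<^sub>m q \<in> carrier_mat m m" for q
    using A B by auto
  have step: "kron (A ^\<^sub>m p) (B ^\<^sub>m q) * ?L =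
      kron (A ^\<^sub>m Suc p) (B ^\<^sub>m q) + kron (A ^\<^sub>m p) (B ^\<^sub>m Suc q)" for p q
    using mult_add_distrib_mat[OF K[OF pA pB] K[OF A one_carrier_mat] K[OF one_carrier_mat B], of p q]
      kron_mult[OF pA A pB one_carrier_mat, of p q] kron_mult[OF pA one_carrier_mat pB B, of p q]
      right_mult_one_mat[OF pA] right_mult_one_mat[OF pB]
    by simp
  have "(?L ^\<^sub>m Suc k) $$ (i, j) = (\<Sum>l<n * m. (?L ^\<^sub>m k) $$ (i, l) * ?L $$ (l, j))"
    using index_mult_mat_sum[OF pow_carrier_mat[OF L] L i Suc.prems] by simp
  also have "\<dots> = (\<Sum>l<n * m. (\<Sum>p\<le>k. of_nat (k choose p) * kron (A ^\<^sub>m p) (B ^\<^sub>m (k - p)) $$ (i, l))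
      * ?L $$ (l, j))"
    by (intro sum.cong refl) (simp only: Suc.IH lessThan_iff)
  also have "\<dots> = (\<Sum>p\<le>k. of_nat (k choose p) *
      (\<Sum>l<n * m. kron (A ^\<^sub>m p) (B ^\<^sub>m (k - p)) $$ (i, l) * ?L $$ (l, j)))"
    unfolding sum_distrib_right sum_distrib_left by (subst sum.swap) (simp add: mult.assoc)
  also have "\<dots> = (\<Sum>p\<le>k. of_nat (k choose p) * (kron (A ^\<^sub>m p) (B ^\<^sub>m (k - p)) * ?L) $$ (i, j))"
    by (simp only: index_mult_mat_sum[OF K[OF pA pB] L i Suc.prems])
  also have "\<dots> = (\<Sum>p\<le>k. of_nat (k choose p) * (kron (A ^\<^sub>m Suc p) (B ^\<^sub>m (k - p)) $$ (i, j)
      + kron (A ^\<^sub>m p) (B ^\<^sub>m Suc (k - p)) $$ (i, j)))"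
    unfolding step using A B i Suc.prems
    by (intro sum.cong refl arg_cong2[where f = "(*)"] index_add_mat)
       (simp_all del: pow_mat.simps)
  also have "\<dots> = (\<Sum>p\<le>Suc k. of_nat (Suc k choose p) * kron (A ^\<^sub>m p) (B ^\<^sub>m (Suc k - p)) $$ (i, j))"
    by (rule sum_binomial_Suc[symmetric])
  finally show ?case .
qed

lemma mat_exp_kron_sum:
  assumes A: "A \<in> carrier_mat n n" and B: "B \<in> carrier_mat m m"
  shows "mat_exp (kron A (1\<^sub>m m) + kron (1\<^sub>m n) B) = kron (mat_exp A) (mat_exp B)"
proof (rule eq_matI)
  fix i j assume "i < dim_row (kron (mat_exp A) (mat_exp B))" "j < dim_col (kron (mat_exp A) (mat_exp B))"
  then have i: "i < n * m" and j: "j < n * m"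
    using mat_exp_carrier[OF A] mat_exp_carrier[OF B] by auto
  let ?L = "kron A (1\<^sub>m m) + kron (1\<^sub>m n) B"
  have L: "?L \<in> carrier_mat (n * m) (n * m)" using A B by (intro add_carrier_mat kron_carrier) auto
  \<comment> \<open>Since (k choose p) / k! = 1 / (p! (k - p)!), the factorials distribute over the
    two series.\<close>
  have "(?L ^\<^sub>m k) $$ (i, j) / fact k = (\<Sum>p\<le>k. (A ^\<^sub>m p) $$ (i div m, j div m) / fact p *
      ((B ^\<^sub>m (k - p)) $$ (i mod m, j mod m) / fact (k - p)))" for k
    unfolding index_kron_sum_pow[OF A B i j] sum_divide_distrib
    using i j A B by (intro sum.cong refl) (simp add: binomial_fact index_kron)
  then have "mat_exp ?L $$ (i, j) =
      mat_exp A $$ (i div m, j div m) * mat_exp B $$ (i mod m, j mod m)"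
    using mat_exp_entry_Cauchy_product[OF A div_mod_less(1)[OF i] div_mod_less(1)[OF j]
        B div_mod_less(2)[OF i] div_mod_less(2)[OF j]]
    by (simp add: index_mat_exp[OF L i j] sums_iff)
  then show "mat_exp ?L $$ (i, j) = kron (mat_exp A) (mat_exp B) $$ (i, j)"
    using mat_exp_carrier[OF A] mat_exp_carrier[OF B] i j by (simp add: index_kron)
qed (use A B in \<open>auto simp: mat_exp_def\<close>)

lemma mat_exp_zero: "mat_exp (0\<^sub>m n n) = 1\<^sub>m n"
proof (rule eq_matI)
  fix i j assume "i < dim_row (1\<^sub>m n :: real mat)" "j < dim_col (1\<^sub>m n :: real mat)"
  then have ij: "i < n" "j < n" by auto
  have "(0\<^sub>m n n ^\<^sub>m k) $$ (i, j) / fact k = (if k = 0 then 1\<^sub>m n $$ (i, j) else 0 :: real)" for k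
    using ij by (cases k) auto
  then show "mat_exp (0\<^sub>m n n) $$ (i, j) = 1\<^sub>m n $$ (i, j)"
    using sums_single[of 0 "\<lambda>_. 1\<^sub>m n $$ (i, j) :: real"] ij
    by (simp add: index_mat_exp[of _ n] sums_iff eq_commute)
qed (auto simp: mat_exp_def)

lemma mat_exp_laplacian_sum:
  assumes "square_mats ns As"
  shows "mat_exp (laplacian_sum ns As) = kron_list (map mat_exp As)"
  using assms
proof (induction ns As rule: list_all2_induct)
  case Nil
  then show ?case by (simp add: mat_exp_zero del: One_nat_def)
next
  case (Cons n ns A As)
  then show ?case
    by (simp add: laplacian_sum_Cons mat_exp_kron_sum[OF _ laplacian_sum_carrier])
qed

section \<open>Algebraic structure\<close>

lemma carrier_GL: "carrier (GL n) = {A \<in> carrier_mat n n. det A \<noteq> 0}"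
  using det_non_zero_imp_unit[of _ n "()"] unit_imp_det_non_zero[where n = n and b = "()"]
  by (auto simp: GL_def units_of_carrier Units_def ring_mat_simps)

lemma mult_GL [simp]: "mult (GL n) = (*)"
  and one_GL [simp]: "one (GL n) = 1\<^sub>m n"
  by (simp_all add: GL_def units_of_mult units_of_one ring_mat_simps)

lemma group_GL: "group (GL n)"
proof -
  interpret ring "ring_mat TYPE(real) n ()" by (rule ring_mat)
  show ?thesis unfolding GL_def by (rule units_group)
qed

text \<open>A one-sided inverse suffices, since the determinants multiply to 1.\<close>

lemma carrier_GL_I:
  assumes "A \<in> carrier_mat n n" "B \<in> carrier_mat n n" "A * B = 1\<^sub>m n"
  shows "A \<in> carrier (GL n)" and "B \<in> carrier (GL n)"
proof -
  have "det A * det B = 1" using assms det_mult[of A n B] by simp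
  then show "A \<in> carrier (GL n)" "B \<in> carrier (GL n)" using assms by (auto simp: carrier_GL)
qed

lemma inv_GL_eq:
  assumes "A \<in> carrier_mat n n" "B \<in> carrier_mat n n" "A * B = 1\<^sub>m n"
  shows "inv\<^bsub>GL n\<^esub> B = A"
  using carrier_GL_I[OF assms] assms by (intro group.inv_equality[OF group_GL]) auto

lemma inv_GL_adj_mat:
  assumes "A \<in> carrier (GL n)"
  shows "inv\<^bsub>GL n\<^esub> A = inverse (det A) \<cdot>\<^sub>m adj_mat A"
proof (rule inv_GL_eq)
  have A: "A \<in> carrier_mat n n" "det A \<noteq> 0" using assms by (auto simp: carrier_GL)
  then show "A \<in> carrier_mat n n" "inverse (det A) \<cdot>\<^sub>m adj_mat A \<in> carrier_mat n n"
    using adj_mat(1)[OF A(1)] by auto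
  show "inverse (det A) \<cdot>\<^sub>m adj_mat A * A = 1\<^sub>m n"
    using A adj_mat[OF A(1)] by (subst mult_smult_assoc_mat[of _ n n _ n]) auto
qed

lemma GL_mats_square_mats:
  "list_all2 (\<lambda>n A. A \<in> carrier (GL n)) ns As \<Longrightarrow> square_mats ns As"
  by (erule list_all2_mono) (simp add: carrier_GL)

text \<open>Inverting factor by factor. The result shows both that the product is nonsingular and
  that its inverse is again a Kronecker product.\<close>

lemma kron_list_inverse:
  assumes "list_all2 (\<lambda>n A. A \<in> carrier (GL n)) ns As"
  obtains Bs where "list_all2 (\<lambda>n A. A \<in> carrier (GL n)) ns Bs"
    and "kron_list Bs * kron_list As = 1\<^sub>m (prod_list ns)"
proof
  let ?Bs = "map2 (\<lambda>n A. inv\<^bsub>GL n\<^esub> A) ns As"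
  have A: "length As = length ns" "As ! i \<in> carrier (GL (ns ! i))" if "i < length ns" for i
    using assms that by (auto simp: list_all2_conv_all_nth)
  have l: "length As = length ns" using assms by (simp add: list_all2_conv_all_nth)
  show B: "list_all2 (\<lambda>n A. A \<in> carrier (GL n)) ns ?Bs"
    using A l group.inv_closed[OF group_GL] by (auto simp: list_all2_conv_all_nth)
  have "map2 (*) ?Bs As = map 1\<^sub>m ns"
    using A l group.l_inv[OF group_GL] by (intro nth_equalityI) auto
  then show "kron_list ?Bs * kron_list As = 1\<^sub>m (prod_list ns)"
    using kron_list_mult[OF B[THEN GL_mats_square_mats] assms[THEN GL_mats_square_mats]]
    by (simp add: kron_list_one)
qed

lemma subgroup_kron_group: "subgroup (kron_group ns) (GL (prod_list ns))"
proof (rule group.subgroupI[OF group_GL])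
  note carrier = kron_list_carrier[OF GL_mats_square_mats]
  show "kron_group ns \<subseteq> carrier (GL (prod_list ns))"
  proof
    fix M assume "M \<in> kron_group ns"
    then obtain As where M: "M = kron_list As" and As: "list_all2 (\<lambda>n A. A \<in> carrier (GL n)) ns As"
      by (auto simp: kron_group_def)
    obtain Bs where "list_all2 (\<lambda>n A. A \<in> carrier (GL n)) ns Bs"
      "kron_list Bs * kron_list As = 1\<^sub>m (prod_list ns)"
      using kron_list_inverse[OF As] .
    then show "M \<in> carrier (GL (prod_list ns))"
      using carrier_GL_I(2) carrier As M by blast
  qed
  have "list_all2 (\<lambda>n A. A \<in> carrier (GL n)) ns (map 1\<^sub>m ns)"
    by (auto simp: list_all2_conv_all_nth carrier_GL)
  then show "kron_group ns \<noteq> {}" by (auto simp: kron_group_def)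
  show "inv\<^bsub>GL (prod_list ns)\<^esub> M \<in> kron_group ns" if M': "M \<in> kron_group ns" for M
  proof -
    obtain As where M: "M = kron_list As" and As: "list_all2 (\<lambda>n A. A \<in> carrier (GL n)) ns As"
      using M' by (auto simp: kron_group_def)
    obtain Bs where "list_all2 (\<lambda>n A. A \<in> carrier (GL n)) ns Bs"
      "kron_list Bs * kron_list As = 1\<^sub>m (prod_list ns)"
      using kron_list_inverse[OF As] .
    then show ?thesis
      using inv_GL_eq[OF carrier carrier[OF As]] M by (auto simp: kron_group_def)
  qed
  show "M \<otimes>\<^bsub>GL (prod_list ns)\<^esub> K \<in> kron_group ns" if MK: "M \<in> kron_group ns" "K \<in> kron_group ns" for M K
  proof -
    obtain As Bs where M: "M = kron_list As" "K = kron_list Bs"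
      and As: "list_all2 (\<lambda>n A. A \<in> carrier (GL n)) ns As"
      and Bs: "list_all2 (\<lambda>n A. A \<in> carrier (GL n)) ns Bs"
      using MK by (auto simp: kron_group_def)
    have "list_all2 (\<lambda>n A. A \<in> carrier (GL n)) ns (map2 (*) As Bs)"
      using As Bs group.is_monoid[OF group_GL, THEN monoid.m_closed] 
      by (auto simp: list_all2_conv_all_nth)
    then show ?thesis
      using kron_list_mult[OF As[THEN GL_mats_square_mats] Bs[THEN GL_mats_square_mats]] M
      by (auto simp: kron_group_def)
  qed
qed

lemma mat_exp_GL: "A \<in> carrier_mat n n \<Longrightarrow> mat_exp A \<in> carrier (GL n)"
  by (rule carrier_GL_I(1)[OF _ _ mat_exp_inverse]) (auto intro: mat_exp_carrier)

lemma mat_exp_laplacian_like: "mat_exp ` laplacian_like ns \<subseteq> kron_group ns"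
proof -
  have "mat_exp (laplacian_sum ns As) \<in> kron_group ns" if "square_mats ns As" for As
  proof -
    have "list_all2 (\<lambda>n A. A \<in> carrier (GL n)) ns (map mat_exp As)"
      using that by (auto simp: list_all2_map2 intro: list_all2_mono mat_exp_GL)
    then show ?thesis using mat_exp_laplacian_sum[OF that] by (auto simp: kron_group_def)
  qed
  then show ?thesis by (auto simp: laplacian_like_def)
qed

section \<open>The Lie algebra of Laplacian-like matrices\<close>

lemma vectorspace_module_mat: "vectorspace class_ring (module_mat TYPE(real) n m)"
proof -
  have "module class_ring (module_mat TYPE(real) n m)"
    by (intro moduleI abelian_group_mat class_cring.cring_axioms)
       (auto simp: module_mat_simps add_smult_distrib_right_mat add_smult_distrib_left_mat
         intro!: eq_matI)
  then show ?thesis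
    unfolding vectorspace_def using class_field.field_axioms by blast
qed

lemma lie_subalgebra_laplacian_like: "lie_subalgebra (prod_list ns) (laplacian_like ns)"
  unfolding lie_subalgebra_def
proof (intro conjI ballI)
  let ?N = "prod_list ns"
  have zero: "0\<^sub>m ?N ?N \<in> laplacian_like ns"
  proof -
    let ?Z = "map (\<lambda>n. 0\<^sub>m n n) ns"
    have Z: "square_mats ns ?Z" by (auto simp: list_all2_conv_all_nth)
    \<comment> \<open>Scaling a list of zero matrices by 0 does not change it, so its Laplacian sum
      equals 0 times itself.\<close>
    have "laplacian_sum ns ?Z = 0 \<cdot>\<^sub>m laplacian_sum ns ?Z"
      using laplacian_sum_smult[OF Z, of 0] by (simp add: comp_def)
    also have "\<dots> = 0\<^sub>m ?N ?N"
      using laplacian_sum_carrier[OF Z] by (auto intro!: eq_matI)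
    finally show ?thesis using Z by (auto simp: laplacian_like_def intro!: exI[of _ ?Z])
  qed
  have add: "A + B \<in> laplacian_like ns" if LAB: "A \<in> laplacian_like ns" "B \<in> laplacian_like ns" for A B
  proof -
    obtain As Bs where AB: "A = laplacian_sum ns As" "B = laplacian_sum ns Bs"
      "square_mats ns As" "square_mats ns Bs"
      using LAB by (auto simp: laplacian_like_def)
    then have "square_mats ns (map2 (+) As Bs)" by (auto simp: list_all2_conv_all_nth)
    then show ?thesis using laplacian_sum_add[OF AB(3,4)] AB by (auto simp: laplacian_like_def)
  qed
  have smult: "c \<cdot>\<^sub>m A \<in> laplacian_like ns" if LA: "A \<in> laplacian_like ns" for c A
  proof -
    obtain As where A: "A = laplacian_sum ns As" "square_mats ns As"
      using LA by (auto simp: laplacian_like_def)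
    then have "square_mats ns (map ((\<cdot>\<^sub>m) c) As)" by (auto simp: list_all2_conv_all_nth)
    then show ?thesis using laplacian_sum_smult[OF A(2)] A by (auto simp: laplacian_like_def)
  qed
  have "submodule class_ring (laplacian_like ns) (module_mat TYPE(real) ?N ?N)"
    using vectorspace_module_mat[of ?N ?N] zero add smult laplacian_sum_carrier
    unfolding submodule_def vectorspace_def
    by (auto simp: module_mat_simps laplacian_like_def)
  then show "VectorSpace.subspace class_ring (laplacian_like ns) (module_mat TYPE(real) ?N ?N)"
    using vectorspace_module_mat by (simp add: subspace_def)
  show "A * B - B * A \<in> laplacian_like ns" if LAB: "A \<in> laplacian_like ns" "B \<in> laplacian_like ns" for A B
  proof -
    obtain As Bs where AB: "A = laplacian_sum ns As" "B = laplacian_sum ns Bs"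
      "square_mats ns As" "square_mats ns Bs"
      using LAB by (auto simp: laplacian_like_def)
    then have "square_mats ns (map2 (\<lambda>A B. A * B - B * A) As Bs)"
      by (auto simp: list_all2_conv_all_nth intro!: minus_carrier_mat mult_carrier_mat)
    then show ?thesis using laplacian_sum_bracket[OF AB(3,4)] AB by (auto simp: laplacian_like_def)
  qed
qed

section \<open>Multi-indices of Kronecker products\<close>

text \<open>Mixed-radix digits, the first factor being the most significant, in accordance with the
  \<open>div\<close> and \<open>mod\<close> of \<open>kron\<close>. The value for the empty list is
  a placeholder.\<close>

primrec digit :: "nat list \<Rightarrow> nat \<Rightarrow> nat \<Rightarrow> nat" where
  "digit [] t i = 0"
| "digit (n # ns) t i =
     (case t of 0 \<Rightarrow> i div prod_list ns | Suc s \<Rightarrow> digit ns s (i mod prod_list ns))"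

primrec undigits :: "nat list \<Rightarrow> (nat \<Rightarrow> nat) \<Rightarrow> nat" where
  "undigits [] g = 0"
| "undigits (n # ns) g = g 0 * prod_list ns + undigits ns (\<lambda>t. g (Suc t))"

lemma digit_less: "i < prod_list ns \<Longrightarrow> t < length ns \<Longrightarrow> digit ns t i < ns ! t"
  by (induction ns arbitrary: i t) (auto simp: div_mod_less split: nat.splits)

lemma undigits_less: "(\<And>t. t < length ns \<Longrightarrow> g t < ns ! t) \<Longrightarrow> undigits ns g < prod_list ns"
proof (induction ns arbitrary: g)
  case (Cons n ns)
  have "undigits ns (\<lambda>t. g (Suc t)) < prod_list ns"
    using Cons.prems[of "Suc _"] by (intro Cons.IH) auto
  then have "undigits (n # ns) g < Suc (g 0) * prod_list ns" by simp
  also have "\<dots> \<le> n * prod_list ns"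
    using Cons.prems[of 0] by (intro mult_le_mono1) simp
  finally show ?case by simp
qed auto

lemma mult_add_div: "c < b \<Longrightarrow> (a * b + c) div b = a" for a b c :: nat
  by (rule div_nat_eqI) (auto simp: mult.commute)

lemma digit_undigits:
  "(\<And>t. t < length ns \<Longrightarrow> g t < ns ! t) \<Longrightarrow> t < length ns \<Longrightarrow> digit ns t (undigits ns g) = g t"
proof (induction ns arbitrary: g t)
  case (Cons n ns)
  have g: "\<And>t. t < length ns \<Longrightarrow> g (Suc t) < ns ! t"
    using Cons.prems(1)[of "Suc _"] by auto
  have "undigits ns (\<lambda>t. g (Suc t)) < prod_list ns" by (rule undigits_less[OF g])
  then show ?case
    using Cons.IH[OF g] Cons.prems(2) by (auto simp: mult_add_div split: nat.splits)
qed auto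

lemma undigits_digit: "i < prod_list ns \<Longrightarrow> undigits ns (\<lambda>t. digit ns t i) = i"
  by (induction ns arbitrary: i) (auto simp: div_mod_less)

lemma undigits_cong:
  "(\<And>t. t < length ns \<Longrightarrow> g t = h t) \<Longrightarrow> undigits ns g = undigits ns h"
proof (induction ns arbitrary: g h)
  case (Cons n ns)
  have "undigits ns (\<lambda>t. g (Suc t)) = undigits ns (\<lambda>t. h (Suc t))"
    using Cons.prems[of "Suc _"] by (intro Cons.IH) auto
  then show ?case using Cons.prems[of 0] by simp
qed auto

lemma index_kron_list:
  assumes "square_mats ns As" and "i < prod_list ns" and "j < prod_list ns"
  shows "kron_list As $$ (i, j) = (\<Prod>t<length ns. As ! t $$ (digit ns t i, digit ns t j))"
  using assms
proof (induction ns As arbitrary: i j rule: list_all2_induct)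
  case (Cons n ns A As)
  have i: "i < n * prod_list ns" and j: "j < n * prod_list ns" using Cons.prems by auto
  show ?case
    using Cons.hyps kron_list_carrier[OF Cons.hyps(2)] i j
      Cons.IH[OF div_mod_less(2)[OF i] div_mod_less(2)[OF j]]
    by (simp add: index_kron prod.lessThan_Suc_shift del: prod.lessThan_Suc)
qed auto

text \<open>The flat index \<open>q\<close> of an entry of an \<open>N \<times> N\<close> matrix corresponds to the tuple of the
  positions \<open>entry_digit ns t q\<close> of the entries of the factors. Changing the \<open>t\<close>-th component
  of that of \<open>p\<close> to \<open>u\<close> gives \<open>update_digit ns p t u\<close>.\<close>

definition entry_digit :: "nat list \<Rightarrow> nat \<Rightarrow> nat \<Rightarrow> nat \<times> nat" where
  "entry_digit ns t q = (digit ns t (q div prod_list ns), digit ns t (q mod prod_list ns))"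

definition entry_undigits :: "nat list \<Rightarrow> (nat \<Rightarrow> nat \<times> nat) \<Rightarrow> nat" where
  "entry_undigits ns g =
     undigits ns (\<lambda>t. fst (g t)) * prod_list ns + undigits ns (\<lambda>t. snd (g t))"

definition update_digit :: "nat list \<Rightarrow> nat \<Rightarrow> nat \<Rightarrow> nat \<times> nat \<Rightarrow> nat" where
  "update_digit ns p t u = entry_undigits ns ((\<lambda>s. entry_digit ns s p)(t := u))"

abbreviation box :: "nat list \<Rightarrow> nat \<Rightarrow> (nat \<times> nat) set" where
  "box ns t \<equiv> {..<ns ! t} \<times> {..<ns ! t}"

lemma entry_digit_box:
  "q < prod_list ns * prod_list ns \<Longrightarrow> t < length ns \<Longrightarrow> entry_digit ns t q \<in> box ns t"
  by (auto simp: entry_digit_def div_mod_less intro!: digit_less)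

lemma
  assumes g: "\<And>t. t < length ns \<Longrightarrow> g t \<in> box ns t"
  shows entry_undigits_less: "entry_undigits ns g < prod_list ns * prod_list ns"
    and entry_digit_undigits: "t < length ns \<Longrightarrow> entry_digit ns t (entry_undigits ns g) = g t"
proof -
  have g': "\<And>t. t < length ns \<Longrightarrow> fst (g t) < ns ! t" "\<And>t. t < length ns \<Longrightarrow> snd (g t) < ns ! t"
    using g by (auto simp: mem_Times_iff)
  note less = undigits_less[of ns "\<lambda>t. fst (g t)", OF g'(1)] undigits_less[of ns "\<lambda>t. snd (g t)", OF g'(2)]
  have "entry_undigits ns g < Suc (undigits ns (\<lambda>t. fst (g t))) * prod_list ns"
    using less by (simp add: entry_undigits_def)
  also have "\<dots> \<le> prod_list ns * prod_list ns"
    using less by (intro mult_le_mono1) simp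
  finally show "entry_undigits ns g < prod_list ns * prod_list ns" .
  show "entry_digit ns t (entry_undigits ns g) = g t" if "t < length ns"
    using less that digit_undigits[OF g'(1) that] digit_undigits[OF g'(2) that]
    by (simp add: entry_undigits_def entry_digit_def mult_add_div)
qed

lemma entry_undigits_digit:
  assumes "q < prod_list ns * prod_list ns"
  shows "entry_undigits ns (\<lambda>t. entry_digit ns t q) = q"
  using div_mod_less[OF assms] by (simp add: entry_undigits_def entry_digit_def undigits_digit)

lemma entry_digit_inject:
  assumes "q < prod_list ns * prod_list ns" "q' < prod_list ns * prod_list ns"
    and "\<And>t. t < length ns \<Longrightarrow> entry_digit ns t q = entry_digit ns t q'"
  shows "q = q'"
proof -
  have "entry_undigits ns (\<lambda>t. entry_digit ns t q) = entry_undigits ns (\<lambda>t. entry_digit ns t q')"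
    unfolding entry_undigits_def using assms(3)
    by (intro arg_cong2[where f = "(+)"] arg_cong2[where f = "(*)"] undigits_cong) auto
  then show ?thesis using assms(1,2) by (simp add: entry_undigits_digit)
qed

lemma
  assumes p: "p < prod_list ns * prod_list ns" and u: "u \<in> box ns t"
  shows update_digit_less: "update_digit ns p t u < prod_list ns * prod_list ns"
    and entry_digit_update: "s < length ns \<Longrightarrow>
      entry_digit ns s (update_digit ns p t u) = (if s = t then u else entry_digit ns s p)"
proof -
  have g: "((\<lambda>s. entry_digit ns s p)(t := u)) s \<in> box ns s" if "s < length ns" for s
    using entry_digit_box[OF p that] u by auto
  show "update_digit ns p t u < prod_list ns * prod_list ns"
    unfolding update_digit_def by (rule entry_undigits_less[OF g])
  show "entry_digit ns s (update_digit ns p t u) = (if s = t then u else entry_digit ns s p)"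
    if "s < length ns"
    using entry_digit_undigits[of ns "(\<lambda>s. entry_digit ns s p)(t := u)", OF g that]
    by (simp add: update_digit_def)
qed

lemma update_digit_same:
  assumes "p < prod_list ns * prod_list ns" "t < length ns"
  shows "update_digit ns p t (entry_digit ns t p) = p"
  using assms entry_digit_box[OF assms]
  by (intro entry_digit_inject[of _ ns]) (auto simp: entry_digit_update update_digit_less)

text \<open>The union of the coordinate lines through \<open>p\<close>, one for each factor. These
  positions are the free coordinates of the graph.\<close>

definition cross :: "nat list \<Rightarrow> nat \<Rightarrow> nat set" where
  "cross ns p = (\<Union>t<length ns. update_digit ns p t ` box ns t)"

text \<open>The pivot lies on every line, and there is a line because the list is nonempty. The
  graph function divides by the pivot coordinate, so that coordinate has to be a free one.\<close>

lemma pivot_in_cross: "ns \<noteq> [] \<Longrightarrow> p < prod_list ns * prod_list ns \<Longrightarrow> p \<in> cross ns p"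
  unfolding cross_def
  by (rule UN_I[of 0], simp, rule image_eqI[of _ _ "entry_digit ns 0 p"])
     (simp_all add: update_digit_same entry_digit_box del: mem_Sigma_iff)

lemma cross_subset: "p < prod_list ns * prod_list ns \<Longrightarrow> cross ns p \<subseteq> {..<prod_list ns * prod_list ns}"
  by (auto simp: cross_def update_digit_less)

text \<open>The lines meet only in \<open>p\<close>, and the line of factor \<open>t\<close> has
  \<open>ns ! t * ns ! t\<close> points. The count is the same for every pivot, as a common
  dimension of all charts requires.\<close>

lemma card_cross:
  assumes ns: "ns \<noteq> []" and p: "p < prod_list ns * prod_list ns"
  shows "card (cross ns p) = Suc (\<Sum>t<length ns. ns ! t * ns ! t - 1)"
proof -
  let ?e = "\<lambda>t. entry_digit ns t p"
  \<comment> \<open>Leaving out the pivot's own component gives punctured lines \<open>C t\<close>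
    that are disjoint and avoid \<open>p\<close>.\<close>
  define I where "I t = box ns t - {?e t}" for t
  define C where "C t = update_digit ns p t ` I t" for t
  have upd: "entry_digit ns s (update_digit ns p t u) = (if s = t then u else ?e s)"
    if "u \<in> I t" "s < length ns" for s t u
    using that entry_digit_update[OF p] unfolding I_def by blast
  have cross: "update_digit ns p t ` box ns t = insert p (C t)" if "t < length ns" for t
  proof -
    have "box ns t = insert (?e t) (I t)"
      using entry_digit_box[OF p that] unfolding I_def by blast
    then show ?thesis using update_digit_same[OF p that] by (simp add: C_def)
  qed
  have "cross ns p = insert p (\<Union>t<length ns. C t)"
  proof -
    have "{..<length ns} \<noteq> {}" using ns by auto
    then show ?thesis unfolding cross_def by (simp add: cross)
  qed
  moreover have "p \<notin> C t" if "t < length ns" for t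
  proof
    assume "p \<in> C t"
    then obtain u where u: "u \<in> I t" "p = update_digit ns p t u" unfolding C_def by (rule imageE)
    then have "u = ?e t" using upd[OF u(1) that] by simp
    then show False using u(1) by (simp add: I_def)
  qed
  moreover have fin: "finite (C t)" for t by (simp add: C_def I_def)
  ultimately have "card (cross ns p) = Suc (card (\<Union>t<length ns. C t))"
    by (simp add: card_insert_disjoint)
  also have "card (\<Union>t<length ns. C t) = (\<Sum>t<length ns. card (C t))"
  proof (rule card_UN_disjoint)
    have "C t \<inter> C s = {}" if ts: "t < length ns" "t \<noteq> s" for t s
    proof (rule equals0I)
      fix q assume "q \<in> C t \<inter> C s"
      then obtain u v where u: "u \<in> I t" "q = update_digit ns p t u"
        and v: "v \<in> I s" "q = update_digit ns p s v" unfolding C_def by blast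
      then have "u = ?e t" using upd[OF u(1) ts(1)] upd[OF v(1) ts(1)] ts(2) by simp
      then show False using u(1) by (simp add: I_def)
    qed
    then show "\<forall>t\<in>{..<length ns}. \<forall>s\<in>{..<length ns}. t \<noteq> s \<longrightarrow> C t \<inter> C s = {}" by simp
  qed (auto simp: fin)
  also have "\<dots> = (\<Sum>t<length ns. ns ! t * ns ! t - 1)"
  proof (intro sum.cong refl)
    fix t assume "t \<in> {..<length ns}"
    then have t: "t < length ns" by simp
    have "inj_on (update_digit ns p t) (I t)"
      by (rule inj_on_inverseI[of _ "entry_digit ns t"]) (simp add: upd t)
    then have "card (C t) = card (I t)" unfolding C_def by (rule card_image)
    also have "\<dots> = ns ! t * ns ! t - 1"
      using entry_digit_box[OF p t] unfolding I_def by (subst card_Diff_singleton) simp_all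
    finally show "card (C t) = ns ! t * ns ! t - 1" .
  qed
  finally show ?thesis .
qed

section \<open>Matrices as points of Euclidean space\<close>

lemma mat_of_coords_mat_coords:
  "A \<in> carrier_mat n n \<Longrightarrow> mat_of_coords n (mat_coords n A) = A"
proof (intro eq_matI)
  fix i j assume "i < dim_row A" "j < dim_col A" "A \<in> carrier_mat n n"
  then have ij: "i < n" "j < n" by auto
  then have "i * n + j < Suc i * n" by simp
  also have "\<dots> \<le> n * n" using ij by (intro mult_le_mono1) simp
  finally show "mat_of_coords n (mat_coords n A) $$ (i, j) = A $$ (i, j)"
    using ij by (simp add: mat_of_coords_def mat_coords_def)
qed (auto simp: mat_of_coords_def)

lemma mat_coords_topspace: "mat_coords n A \<in> topspace (Euclidean_space (n * n))"
  by (simp add: mat_coords_def topspace_Euclidean_space)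

lemma mat_of_coords_carrier: "mat_of_coords n x \<in> carrier_mat n n"
  by (simp add: mat_of_coords_def)

lemma mat_coords_kron_list:
  assumes "square_mats ns As" and q: "q < prod_list ns * prod_list ns"
  shows "mat_coords (prod_list ns) (kron_list As) q = (\<Prod>t<length ns. As ! t $$ entry_digit ns t q)"
  using div_mod_less[OF q] q by (simp add: mat_coords_def index_kron_list[OF assms(1)] entry_digit_def)

section \<open>The group of Kronecker products as a submanifold\<close>

text \<open>The coordinates on the line of factor \<open>t\<close> through \<open>p\<close>,
  arranged as a matrix. For a Kronecker product with nonzero pivot entry this is a nonzero multiple
  of the factor itself.\<close>

definition kron_factor :: "nat list \<Rightarrow> nat \<Rightarrow> (nat \<Rightarrow> real) \<Rightarrow> nat \<Rightarrow> real mat" where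
  "kron_factor ns p y t = mat (ns ! t) (ns ! t) (\<lambda>u. y (update_digit ns p t u))"

text \<open>Each of the \<open>d\<close> factors \<open>kron_factor ns p y t\<close> of a Kronecker product with coordinates
  \<open>y\<close> carries a surplus \<open>y p\<close>, so that their product has to be divided by \<open>y p ^ (d - 1)\<close>.\<close>

definition weight :: "nat \<Rightarrow> (nat \<Rightarrow> real) \<Rightarrow> nat \<Rightarrow> real" where
  "weight p y t = (if t = 0 then 1 else inverse (y p))"

definition kron_graph :: "nat list \<Rightarrow> nat \<Rightarrow> nat \<Rightarrow> (nat \<Rightarrow> real) \<Rightarrow> real" where
  "kron_graph ns p q y =
     (\<Prod>t<length ns. weight p y t * y (update_digit ns p t (entry_digit ns t q)))"

text \<open>The determinants ensure that the graph over this set consists of products of nonsingular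
  factors. Only coordinates on the cross are involved, so the domain is a full cylinder in the other
  coordinates.\<close>

definition chart_domain :: "nat list \<Rightarrow> nat \<Rightarrow> (nat \<Rightarrow> real) set" where
  "chart_domain ns p = {y \<in> topspace (Euclidean_space (prod_list ns * prod_list ns)).
     y p * (\<Prod>t<length ns. det (kron_factor ns p y t)) \<noteq> 0}"

text \<open>All weights but the one at 0 cancel their \<open>y p\<close>, and a nonempty list
  guarantees that one \<open>y p\<close> is left.\<close>

lemma prod_weight:
  assumes "ns \<noteq> []" "y p \<noteq> 0"
  shows "(\<Prod>t<length ns. weight p y t * y p) = y p"
  using assms
  by (cases ns) (simp_all add: prod.lessThan_Suc_shift weight_def del: prod.lessThan_Suc)

text \<open>Changing one component of a position changes one factor of the product of entries. The
  entry divided by is nonzero because it divides \<open>y p\<close>.\<close>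

lemma mat_coords_kron_list_update:
  assumes As: "square_mats ns As" and p: "p < prod_list ns * prod_list ns"
    and y: "y = mat_coords (prod_list ns) (kron_list As)" and yp: "y p \<noteq> 0"
    and t: "t < length ns" and u: "u \<in> box ns t"
  shows "y (update_digit ns p t u) = y p / As ! t $$ entry_digit ns t p * As ! t $$ u"
proof -
  let ?c = "\<lambda>s. As ! s $$ entry_digit ns s p"
  have yp_eq: "y p = ?c t * (\<Prod>s\<in>{..<length ns} - {t}. ?c s)"
    unfolding y mat_coords_kron_list[OF As p] using t by (intro prod.remove) auto
  have "y (update_digit ns p t u) =
      (\<Prod>s<length ns. As ! s $$ (if s = t then u else entry_digit ns s p))"
    unfolding y mat_coords_kron_list[OF As update_digit_less[OF p u]]
    by (intro prod.cong refl) (simp add: entry_digit_update[OF p u])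
  also have "\<dots> = As ! t $$ u * (\<Prod>s\<in>{..<length ns} - {t}. ?c s)"
    using t by (subst prod.remove[of _ t]) (auto intro!: prod.cong)
  finally show ?thesis using yp yp_eq by auto
qed

text \<open>Each factor of the graph function is \<open>y p\<close> times the ratio of an entry of
  \<open>As ! t\<close> to its pivot entry. The weights leave one \<open>y p\<close>, which cancels
  the product of all pivot entries.\<close>

lemma kron_list_in_graph:
  assumes ns: "ns \<noteq> []" and As: "square_mats ns As" and p: "p < prod_list ns * prod_list ns"
    and y: "y = mat_coords (prod_list ns) (kron_list As)" and yp: "y p \<noteq> 0"
    and q: "q < prod_list ns * prod_list ns"
  shows "y q = kron_graph ns p q y"
proof -
  let ?c = "\<lambda>s. As ! s $$ entry_digit ns s p"
  have "kron_graph ns p q y =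
      (\<Prod>t<length ns. (weight p y t * y p) * (As ! t $$ entry_digit ns t q / ?c t))"
    unfolding kron_graph_def using entry_digit_box[OF q]
    by (intro prod.cong refl)
       (simp add: mat_coords_kron_list_update[OF As p y yp] del: mem_Sigma_iff)
  also have "\<dots> = y p * ((\<Prod>t<length ns. As ! t $$ entry_digit ns t q) / (\<Prod>t<length ns. ?c t))"
    by (simp only: prod.distrib prod_weight[of ns y p, OF ns yp, unfolded prod.distrib] prod_dividef)
  also have "\<dots> = y q"
    using yp unfolding y mat_coords_kron_list[OF As p] mat_coords_kron_list[OF As q] by simp
  finally show ?thesis ..
qed

lemma kron_factor_kron_list:
  assumes "square_mats ns As" "p < prod_list ns * prod_list ns"
    and "y = mat_coords (prod_list ns) (kron_list As)" "y p \<noteq> 0" and t: "t < length ns"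
  shows "kron_factor ns p y t = (y p / As ! t $$ entry_digit ns t p) \<cdot>\<^sub>m As ! t"
  using assms(1) t
  by (intro eq_matI)
     (auto simp: kron_factor_def list_all2_conv_all_nth mat_coords_kron_list_update[OF assms])

lemma kron_list_in_chart_domain:
  assumes GL: "list_all2 (\<lambda>n A. A \<in> carrier (GL n)) ns As"
    and p: "p < prod_list ns * prod_list ns"
    and y: "y = mat_coords (prod_list ns) (kron_list As)" and yp: "y p \<noteq> 0"
  shows "y \<in> chart_domain ns p"
proof -
  note As = GL_mats_square_mats[OF GL]
  have "det (kron_factor ns p y t) \<noteq> 0" if t: "t < length ns" for t
  proof -
    have "As ! t $$ entry_digit ns t p \<noteq> 0"
      using yp t unfolding y mat_coords_kron_list[OF As p] by auto
    moreover have "det (As ! t) \<noteq> 0"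
      using GL t by (auto simp: list_all2_conv_all_nth carrier_GL)
    ultimately show ?thesis
      using yp by (simp add: kron_factor_kron_list[OF As p y yp t])
  qed
  then show ?thesis
    using yp mat_coords_topspace[of "prod_list ns"] y by (auto simp: chart_domain_def)
qed

text \<open>On the line of factor \<open>t\<close> all other factors of the formula reduce to
  weighted copies of \<open>y p\<close>. Hence imposing the graph equation off the cross makes it
  hold at every position.\<close>

lemma kron_graph_cross:
  assumes ns: "ns \<noteq> []" and p: "p < prod_list ns * prod_list ns" and yp: "y p \<noteq> 0"
    and q: "q \<in> cross ns p"
  shows "kron_graph ns p q y = y q"
proof -
  obtain t u where t: "t < length ns" and u: "u \<in> box ns t" and q: "q = update_digit ns p t u"
    using q unfolding cross_def by blast
  have "kron_graph ns p q y = (\<Prod>s<length ns. (weight p y s * y p) * (if s = t then y q / y p else 1))"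
    unfolding kron_graph_def using yp
    by (intro prod.cong refl) (simp add: q entry_digit_update[OF p u] update_digit_same[OF p])
  also have "\<dots> = y q"
    using t yp by (simp add: prod.distrib[of "\<lambda>s. weight p y s * y p"] prod_weight[of ns y p, OF ns yp])
  finally show ?thesis .
qed

lemma kron_group_eq_graph:
  assumes ns: "ns \<noteq> []" and p: "p < prod_list ns * prod_list ns"
  defines "N \<equiv> prod_list ns"
  shows "mat_coords N ` kron_group ns \<inter> chart_domain ns p =
    {y \<in> chart_domain ns p. \<forall>q\<in>{..<N * N} - cross ns p. y q = kron_graph ns p q y}"
proof (intro equalityI subsetI)
  fix y assume y: "y \<in> mat_coords N ` kron_group ns \<inter> chart_domain ns p"
  then obtain As where "list_all2 (\<lambda>n A. A \<in> carrier (GL n)) ns As"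
    and eq: "y = mat_coords (prod_list ns) (kron_list As)"
    unfolding kron_group_def N_def by blast
  moreover have "y p \<noteq> 0" using y by (simp add: chart_domain_def)
  ultimately show "y \<in> {y \<in> chart_domain ns p. \<forall>q\<in>{..<N * N} - cross ns p. y q = kron_graph ns p q y}"
    using y kron_list_in_graph[OF ns GL_mats_square_mats p eq] unfolding N_def by auto
next
  fix y assume "y \<in> {y \<in> chart_domain ns p. \<forall>q\<in>{..<N * N} - cross ns p. y q = kron_graph ns p q y}"
  then have dom: "y \<in> chart_domain ns p"
    and g: "\<And>q. q \<in> {..<N * N} - cross ns p \<Longrightarrow> y q = kron_graph ns p q y" by auto
  have yp: "y p \<noteq> 0" and det: "\<And>t. t < length ns \<Longrightarrow> det (kron_factor ns p y t) \<noteq> 0"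
    using dom by (auto simp: chart_domain_def)
  \<comment> \<open>The lines through \<open>p\<close> yield the factors, and the weights make the
    product of their entries exactly \<open>kron_graph\<close>.\<close>
  let ?As = "map (\<lambda>t. weight p y t \<cdot>\<^sub>m kron_factor ns p y t) [0..<length ns]"
  have "weight p y t \<noteq> 0" for t using yp by (simp add: weight_def)
  then have GL: "list_all2 (\<lambda>n A. A \<in> carrier (GL n)) ns ?As"
    using det by (auto simp: list_all2_conv_all_nth carrier_GL kron_factor_def)
  have entry: "(c \<cdot>\<^sub>m kron_factor ns p y t) $$ u = c * y (update_digit ns p t u)" if "u \<in> box ns t" for c t u
    using that by (cases u) (simp add: kron_factor_def)
  have "y q = mat_coords N (kron_list ?As) q" for q
  proof (cases "q < N * N")
    case True
    have "mat_coords N (kron_list ?As) q = kron_graph ns p q y"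
      unfolding N_def mat_coords_kron_list[OF GL_mats_square_mats[OF GL] True[unfolded N_def]]
        kron_graph_def
      using entry_digit_box[OF True[unfolded N_def]]
      by (intro prod.cong refl) (simp add: entry del: mem_Sigma_iff)
    also have "\<dots> = y q"
      using g[of q] kron_graph_cross[where y = y, OF ns p yp, of q] True
      by (cases "q \<in> cross ns p") simp_all
    finally show ?thesis ..
  next
    case False
    then show ?thesis using dom by (simp add: chart_domain_def topspace_Euclidean_space mat_coords_def N_def)
  qed
  then have "y = mat_coords N (kron_list ?As)" by blast
  then show "y \<in> mat_coords N ` kron_group ns \<inter> chart_domain ns p"
    using dom GL unfolding kron_group_def by blast
qed

lemma chart_domain_open:
  "openin (Euclidean_space (prod_list ns * prod_list ns)) (chart_domain ns p)"
  unfolding chart_domain_def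
proof (intro openin_rational_nonzero rational_on.mult rational_on_prod rational_on.coord)
  fix t
  show "rational_on (topspace (Euclidean_space (prod_list ns * prod_list ns)))
      (\<lambda>y. det (kron_factor ns p y t))"
    by (rule rational_on_det[of _ "ns ! t"]) (auto simp: kron_factor_def intro: rational_on.coord)
qed

text \<open>A nonsingular matrix of positive size has a nonzero entry; the positions of such entries
  in all factors combine to one position in the product.\<close>

lemma ex_pivot:
  assumes GL: "list_all2 (\<lambda>n A. A \<in> carrier (GL n)) ns As" and pos: "\<forall>n\<in>set ns. 0 < n"
  obtains p where "p < prod_list ns * prod_list ns"
    and "mat_coords (prod_list ns) (kron_list As) p \<noteq> 0"
proof -
  have "\<exists>u\<in>box ns t. As ! t $$ u \<noteq> 0" if t: "t < length ns" for t
  proof (rule ccontr)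
    assume *: "\<not> (\<exists>u\<in>box ns t. As ! t $$ u \<noteq> 0)"
    have A: "As ! t \<in> carrier_mat (ns ! t) (ns ! t)" "det (As ! t) \<noteq> 0"
      using GL t by (auto simp: list_all2_conv_all_nth carrier_GL)
    \<comment> \<open>In this form the determinant of the zero matrix is a power of 0, which
      vanishes because the size is positive.\<close>
    have "As ! t = 0 \<cdot>\<^sub>m 1\<^sub>m (ns ! t)" using * A by (intro eq_matI) auto
    then have "det (As ! t) = 0 ^ (ns ! t)" by simp
    then show False using A(2) pos t by (simp add: zero_power)
  qed
  then obtain g where g: "\<And>t. t < length ns \<Longrightarrow> g t \<in> box ns t \<and> As ! t $$ g t \<noteq> 0" by metis
  let ?p = "entry_undigits ns g"
  have p: "?p < prod_list ns * prod_list ns" using g by (intro entry_undigits_less) blast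
  have "entry_digit ns t ?p = g t" if "t < length ns" for t
    using g that by (intro entry_digit_undigits) blast+
  then have "mat_coords (prod_list ns) (kron_list As) ?p \<noteq> 0"
    using g by (simp add: mat_coords_kron_list[OF GL_mats_square_mats[OF GL] p])
  then show thesis using that p by blast
qed

lemma embedded_submanifold_kron_group:
  assumes ns: "ns \<noteq> []" and pos: "\<forall>n\<in>set ns. 0 < n"
  defines "N \<equiv> prod_list ns"
  shows "embedded_submanifold (N * N) (Suc (\<Sum>t<length ns. ns ! t * ns ! t - 1))
    (mat_coords N ` kron_group ns)"
    (is "embedded_submanifold _ ?k ?K")
  unfolding embedded_submanifold_def
proof (intro conjI ballI)
  \<comment> \<open>Position 0 exists since \<open>N\<close> is positive, and its cross bounds the
    dimension because all crosses have the same size.\<close>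
  have "0 < N" using pos unfolding N_def by (induction ns) auto
  then have "card (cross ns 0) \<le> N * N"
    using card_mono[OF _ cross_subset[of 0 ns]] unfolding N_def by simp
  then show "?k \<le> N * N" using card_cross[OF ns, of 0] \<open>0 < N\<close> by (simp add: N_def)
  show "?K \<subseteq> topspace (Euclidean_space (N * N))" using mat_coords_topspace by blast
  fix y assume y: "y \<in> ?K"
  then obtain As where GL: "list_all2 (\<lambda>n A. A \<in> carrier (GL n)) ns As"
    and y: "y = mat_coords (prod_list ns) (kron_list As)"
    unfolding kron_group_def N_def by blast
  obtain p where p: "p < prod_list ns * prod_list ns" and yp: "y p \<noteq> 0"
    using ex_pivot[OF GL pos] y by blast
  let ?W = "chart_domain ns p"
  have "\<exists>V \<phi>. openin (Euclidean_space (N * N)) V \<and> diffeo_on (N * N) ?W V \<phi> \<and>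
      \<phi> ` {x \<in> ?W. \<forall>q\<in>{..<N * N} - cross ns p. x q = kron_graph ns p q x} =
      V \<inter> topspace (Euclidean_space (card (cross ns p)))"
  proof (rule graph_slice_chart)
    show "openin (Euclidean_space (N * N)) ?W" unfolding N_def by (rule chart_domain_open)
    show "cross ns p \<subseteq> {..<N * N}" unfolding N_def by (rule cross_subset[OF p])
    show "rational_on ?W (kron_graph ns p q)" for q
    proof -
      have "rational_on ?W (\<lambda>y. weight p y t)" for t
      proof (cases "t = 0")
        case True
        then show ?thesis by (simp add: weight_def rational_on.const)
      next
        case False
        have "rational_on ?W (\<lambda>y. inverse (y p))"
          by (rule rational_on.inverse[OF rational_on.coord]) (simp add: chart_domain_def)
        then show ?thesis using False by (simp add: weight_def)
      qed
      then show ?thesis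
        unfolding kron_graph_def[abs_def]
        by (intro rational_on_prod rational_on.mult rational_on.coord)
    qed
    fix x y q
    assume x: "x \<in> ?W" and y: "y \<in> topspace (Euclidean_space (N * N))"
      and eq: "\<And>s. s \<in> cross ns p \<Longrightarrow> y s = x s"
    \<comment> \<open>Chart domain and graph function read only coordinates on the cross; this is
      the dependence condition of \<open>graph_slice_chart\<close>.\<close>
    have eq': "y (update_digit ns p t u) = x (update_digit ns p t u)"
      if "t < length ns" "u \<in> box ns t" for t u
      using that by (intro eq) (auto simp: cross_def)
    have "y p = x p" by (rule eq[OF pivot_in_cross[OF ns p]])
    moreover have "kron_factor ns p y t = kron_factor ns p x t" if "t < length ns" for t
      using that unfolding kron_factor_def by (intro cong_mat refl eq') auto
    ultimately have "y \<in> ?W" using x y by (simp add: chart_domain_def N_def)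
    moreover have "kron_graph ns p q y = kron_graph ns p q x" if "q < N * N"
      unfolding kron_graph_def weight_def \<open>y p = x p\<close>
      using entry_digit_box that unfolding N_def by (intro prod.cong refl) (simp add: eq' del: mem_Sigma_iff)
    ultimately show "y \<in> ?W \<and> (q \<in> {..<N * N} - cross ns p \<longrightarrow> kron_graph ns p q y = kron_graph ns p q x)"
      by blast
  qed
  then obtain V \<phi> where "openin (Euclidean_space (N * N)) V" "diffeo_on (N * N) ?W V \<phi>"
    and "\<phi> ` (?K \<inter> ?W) = V \<inter> topspace (Euclidean_space ?k)"
    unfolding N_def kron_group_eq_graph[OF ns p] card_cross[OF ns p] by blast
  then show "\<exists>U V \<phi>. y \<in> U \<and> openin (Euclidean_space (N * N)) U \<and> openin (Euclidean_space (N * N)) V \<and>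
      diffeo_on (N * N) U V \<phi> \<and> \<phi> ` (?K \<inter> U) = V \<inter> topspace (Euclidean_space ?k)"
    using kron_list_in_chart_domain[OF GL p y yp] chart_domain_open[of ns p, folded N_def]
    by (intro exI[of _ ?W] exI[of _ V] exI[of _ \<phi>] conjI)
qed

section \<open>Smoothness of the group operations\<close>

lemma index_mat_of_coords:
  "i < n \<Longrightarrow> j < n \<Longrightarrow> mat_of_coords n x $$ (i, j) = x (i * n + j)"
  by (simp add: mat_of_coords_def)

text \<open>Multiplication is polynomial on the whole space of pairs, for any \<open>H\<close>. The
  coordinates of the second matrix start at \<open>n * n\<close>.\<close>

lemma smooth_on_mult:
  "smooth_on (n * n + n * n) (n * n)
    {z \<in> topspace (Euclidean_space (n * n + n * n)).
       mat_of_coords n z \<in> H \<and> mat_of_coords n (\<lambda>k. z (n * n + k)) \<in> H}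
    (\<lambda>z. mat_coords n (mat_of_coords n z * mat_of_coords n (\<lambda>k. z (n * n + k))))"
proof (rule smooth_on_rational[OF openin_topspace,
    where g = "\<lambda>z j. \<Sum>l<n. z (j div n * n + l) * z (n * n + (l * n + j mod n))"])
  fix z :: "nat \<Rightarrow> real" and j assume j: "j < n * n"
  show "mat_coords n (mat_of_coords n z * mat_of_coords n (\<lambda>k. z (n * n + k))) j =
      (\<Sum>l<n. z (j div n * n + l) * z (n * n + (l * n + j mod n)))"
    using j div_mod_less[OF j]
      index_mult_mat_sum[OF mat_of_coords_carrier mat_of_coords_carrier div_mod_less[OF j]]
    by (simp add: mat_coords_def index_mat_of_coords)
qed (auto intro!: rational_on_sum rational_on.mult rational_on.coord mat_coords_topspace)

text \<open>Entries of the adjugate are signed minors, and the determinant by which they are divided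
  has no zero on the open set of nonsingular matrices.\<close>

lemma smooth_on_inverse:
  assumes H: "H \<subseteq> carrier (GL n)"
  shows "smooth_on (n * n) (n * n) (mat_coords n ` H)
    (\<lambda>x. mat_coords n (inv\<^bsub>GL n\<^esub> (mat_of_coords n x)))"
proof -
  let ?E = "Euclidean_space (n * n)"
  let ?U = "{x \<in> topspace ?E. det (mat_of_coords n x) \<noteq> 0}"
  have entry: "rational_on U (\<lambda>x. mat_of_coords n x $$ (i, j))" if "i < n" "j < n" for U i j
    using that by (simp add: index_mat_of_coords rational_on.coord)
  have det: "rational_on U (\<lambda>x. det (mat_of_coords n x))" for U
    by (rule rational_on_det[OF mat_of_coords_carrier entry])
  have adj: "rational_on U (\<lambda>x. adj_mat (mat_of_coords n x) $$ (i, j))" if ij: "i < n" "j < n" for U i j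
  proof -
    have "rational_on U (\<lambda>x. (- 1) ^ (j + i) * det (mat_delete (mat_of_coords n x) j i))"
    proof (intro rational_on.mult rational_on.const rational_on_det[of _ "n - 1"])
      show "mat_delete (mat_of_coords n x) j i \<in> carrier_mat (n - 1) (n - 1)" for x
        using mat_of_coords_carrier[of n x] by (auto simp: mat_delete_def)
      show "rational_on U (\<lambda>x. mat_delete (mat_of_coords n x) j i $$ (k, l))"
        if kl: "k < n - 1" "l < n - 1" for k l
      proof -
        \<comment> \<open>Indices from the deleted row or column on shift by one, so every entry of
          the minor is again a coordinate of \<open>x\<close>.\<close>
        have "mat_delete (mat_of_coords n x) j i $$ (k, l) =
            mat_of_coords n x $$ (if k < j then k else Suc k, if l < i then l else Suc l)" for x
          using kl mat_of_coords_carrier[of n x] by (simp add: mat_delete_def)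
        then show ?thesis using kl ij by (simp only:) (intro entry; auto simp: less_diff_conv)
      qed
    qed
    then show ?thesis
      using ij carrier_matD[OF mat_of_coords_carrier[of n]] by (simp add: adj_mat_def cofactor_def)
  qed
  have in_H: "mat_of_coords n x \<in> carrier (GL n)" if "x \<in> mat_coords n ` H" for x
    using that H by (auto simp: carrier_GL mat_of_coords_mat_coords)
  show ?thesis
  proof (rule smooth_on_rational[where U = ?U and
      g = "\<lambda>x k. inverse (det (mat_of_coords n x)) * adj_mat (mat_of_coords n x) $$ (k div n, k mod n)"])
    show "openin ?E ?U" by (rule openin_rational_nonzero[OF det])
    show "mat_coords n ` H \<subseteq> ?U"
      using in_H mat_coords_topspace by (auto simp: carrier_GL)
    show "rational_on ?U (\<lambda>x. inverse (det (mat_of_coords n x)) *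
        adj_mat (mat_of_coords n x) $$ (k div n, k mod n))" if "k < n * n" for k
      using div_mod_less[OF that] by (intro rational_on.mult rational_on.inverse det adj) auto
    show "mat_coords n (inv\<^bsub>GL n\<^esub> (mat_of_coords n x)) k =
        inverse (det (mat_of_coords n x)) * adj_mat (mat_of_coords n x) $$ (k div n, k mod n)"
      if "x \<in> mat_coords n ` H" "k < n * n" for x k
      using that(2) div_mod_less[OF that(2)] adj_mat(1)[OF mat_of_coords_carrier[of n x]]
      by (simp add: inv_GL_adj_mat[OF in_H[OF that(1)]] mat_coords_def)
  qed (auto intro: mat_coords_topspace)
qed

lemma lie_subgroup_kron_group:
  assumes "ns \<noteq> []" "\<forall>n\<in>set ns. 0 < n"
  shows "lie_subgroup_GL (prod_list ns) (kron_group ns)"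
  unfolding lie_subgroup_GL_def
proof (intro conjI)
  show "subgroup (kron_group ns) (GL (prod_list ns))" by (rule subgroup_kron_group)
  then show "smooth_on (prod_list ns * prod_list ns) (prod_list ns * prod_list ns)
      (mat_coords (prod_list ns) ` kron_group ns)
      (\<lambda>x. mat_coords (prod_list ns) (inv\<^bsub>GL (prod_list ns)\<^esub> (mat_of_coords (prod_list ns) x)))"
    by (intro smooth_on_inverse subgroup.subset)
qed (rule exI embedded_submanifold_kron_group[OF assms] smooth_on_mult)+

theorem proposition1:
  fixes ns :: "nat list" and N :: nat
  assumes "ns \<noteq> []" and "\<forall>n\<in>set ns. 0 < n" and "N = prod_list ns"
  shows "lie_subalgebra N (laplacian_like ns)
    \<and> lie_subgroup_GL N (kron_group ns)
    \<and> mat_exp ` laplacian_like ns \<subseteq> kron_group ns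
    \<and> (\<forall>As. list_all2 (\<lambda>n A. A \<in> carrier_mat n n) ns As \<longrightarrow>
          mat_exp (laplacian_sum ns As) = kron_list (map mat_exp As))"
proof -
  have "lie_subgroup_GL N (kron_group ns)"
    using lie_subgroup_kron_group[OF assms(1,2)] assms(3) by simp
  then show ?thesis
    using lie_subalgebra_laplacian_like[of ns] mat_exp_laplacian_like[of ns]
    by (simp add: assms(3) mat_exp_laplacian_sum)
qed

end
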